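(* Let $(\xi_i)_{i\in\mathbb{Z}}$ be a stationary sequence of real random variables with $\mathbb{E}|\xi_0|<\infty$ and $\mathbb{E}(\xi_0)=0$, let $\mathcal{I}$ be its invariant $\sigma$-field, let $(a_j)_{j\in\mathbb{Z}}$ be real numbers with $\sum_{j\in\mathbb{Z}}|a_j|<\infty$, and set $A=\sum_{j\in\mathbb{Z}}a_j$, $X_k=\sum_{j=-\infty}^{\infty}a_j\xi_{k-j}$, $S_k=\sum_{j=1}^kX_j$, $S_k^{(\xi)}=\sum_{j=1}^k\xi_j$. Assume that there are a constant $C>0$ and a sequence of positive reals $b_n\to\infty$ such that for all $n\geq 1$ $$\mathbb{E}\Big(\max_{1\leq j\leq n}|S_j^{(\xi)}|\Big)\leq C\,b_n .$$ Assume moreover that the innovations satisfy the invariance principle $$b_n^{-1}S^{(\xi)}_{[nt]}\Longrightarrow \eta W(t)\quad\text{as } n\to\infty,$$ where $\eta$ is an $\mathcal{I}$-measurable random variable and $W$ is a standard Brownian motion on $[0,1]$ independent of $\mathcal{I}$. Then the linear process also satisfies the invariance principle, that is, $$b_n^{-1}S_{[nt]}\Longrightarrow \eta A W(t)\quad\text{as } n\to\infty .$$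
   Context: $[x]$ denotes the integer part of $x$, and $S_0=S_0^{(\xi)}=0$. $\Longrightarrow$ denotes weak convergence, for processes indexed by $t\in[0,1]$, in $D[0,1]$, the space of cadlag functions on $[0,1]$, endowed with the uniform topology. The probability space is assumed rich enough to support a standard Brownian motion independent of $\mathcal{I}$ (the innovations are redefined, without changing distributions, on such a space). *)

theory Defs
  imports "HOL-Probability.Probability"
begin

definition cadlag_on_unit :: "(real \<Rightarrow> real) \<Rightarrow> bool" where
  "cadlag_on_unit f \<longleftrightarrow>
     (\<forall>t\<in>{0..<1}. (f \<longlongrightarrow> f t) (at_right t)) \<and>
     (\<forall>t\<in>{0<..1}. \<exists>l. (f \<longlongrightarrow> l) (at_left t))"

text \<open>The distance on \<^const>\<open>funspace\<close> is the supremum distance. Its points are the bounded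
  functions on \<open>[0,1]\<close> (with value \<^const>\<open>undefined\<close> elsewhere); since cadlag functions on
  \<open>[0,1]\<close> are bounded, no cadlag function is lost.\<close>

definition D_unit :: "(real \<Rightarrow> real) metric" where
  "D_unit = submetric (funspace {0..1} euclidean_metric) {f. cadlag_on_unit f}"

definition borel_of_top :: "'b topology \<Rightarrow> 'b measure" where
  "borel_of_top T = sigma (topspace T) {U. openin T U}"

definition weakly_converges ::
    "'b topology \<Rightarrow> 'a measure \<Rightarrow> (nat \<Rightarrow> 'a \<Rightarrow> 'b) \<Rightarrow> ('a \<Rightarrow> 'b) \<Rightarrow> bool" where
  "weakly_converges T M X Y \<longleftrightarrow>
     (\<forall>n. X n \<in> M \<rightarrow>\<^sub>M borel_of_top T) \<and> Y \<in> M \<rightarrow>\<^sub>M borel_of_top T \<and>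
     (\<forall>f :: 'b \<Rightarrow> real. continuous_map T euclideanreal f \<and> bounded (f ` topspace T) \<longrightarrow>
        (\<lambda>n. \<integral>\<omega>. f (X n \<omega>) \<partial>M) \<longlonglongrightarrow> (\<integral>\<omega>. f (Y \<omega>) \<partial>M))"

definition stationary_sequence :: "'a measure \<Rightarrow> (int \<Rightarrow> 'a \<Rightarrow> real) \<Rightarrow> bool" where
  "stationary_sequence M \<xi> \<longleftrightarrow>
     (\<forall>k. \<xi> k \<in> borel_measurable M) \<and>
     (\<forall>m. distr M (\<Pi>\<^sub>M k\<in>UNIV. borel) (\<lambda>\<omega> k. \<xi> (k + m) \<omega>) =
          distr M (\<Pi>\<^sub>M k\<in>UNIV. borel) (\<lambda>\<omega> k. \<xi> k \<omega>))"

text \<open>Invariance under the shift is strict here; asking for it only up to null sets would give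
  a sigma-field with the same completion.\<close>

definition invariant_field :: "'a measure \<Rightarrow> (int \<Rightarrow> 'a \<Rightarrow> real) \<Rightarrow> 'a measure" where
  "invariant_field M \<xi> = sigma (space M)
     {(\<lambda>\<omega> k. \<xi> k \<omega>) -` B \<inter> space M | B.
        B \<in> sets (\<Pi>\<^sub>M k\<in>(UNIV :: int set). (borel :: real measure)) \<and>
        (\<lambda>x k. x (k + 1)) -` B = B}"

text \<open>Every path, not just almost every one, is continuous, so that \<open>W\<close> takes its values in the
  space of cadlag functions.\<close>

definition standard_brownian_motion :: "'a measure \<Rightarrow> (real \<Rightarrow> 'a \<Rightarrow> real) \<Rightarrow> bool" where
  "standard_brownian_motion M W \<longleftrightarrow>
     (\<forall>t\<in>{0..1}. W t \<in> borel_measurable M) \<and>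
     (AE \<omega> in M. W 0 \<omega> = 0) \<and>
     (\<forall>s t. 0 \<le> s \<and> s < t \<and> t \<le> 1 \<longrightarrow>
        distributed M lborel (\<lambda>\<omega>. W t \<omega> - W s \<omega>) (normal_density 0 (sqrt (t - s)))) \<and>
     (\<forall>(k :: nat) (t :: nat \<Rightarrow> real). strict_mono_on {..k} t \<and> 0 \<le> t 0 \<and> t k \<le> 1 \<longrightarrow>
        prob_space.indep_vars M (\<lambda>_. borel) (\<lambda>i \<omega>. W (t (Suc i)) \<omega> - W (t i) \<omega>) {..<k}) \<and>
     (\<forall>\<omega>\<in>space M. continuous_on {0..1} (\<lambda>t. W t \<omega>))"

definition process_field :: "'a measure \<Rightarrow> (real \<Rightarrow> 'a \<Rightarrow> real) \<Rightarrow> 'a measure" where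
  "process_field M W =
     vimage_algebra (space M) (\<lambda>\<omega>. \<lambda>t\<in>{0..1}. W t \<omega>) (\<Pi>\<^sub>M t\<in>{0..1}. borel)"

text \<open>For absolutely summable \<open>a\<close> and a stationary integrable \<open>\<xi>\<close> the series converges
  absolutely almost surely; on the exceptional null set \<^const>\<open>infsum\<close> yields 0.\<close>

definition linear_process ::
    "(int \<Rightarrow> real) \<Rightarrow> (int \<Rightarrow> 'a \<Rightarrow> real) \<Rightarrow> int \<Rightarrow> 'a \<Rightarrow> real" where
  "linear_process a \<xi> k \<omega> = (\<Sum>\<^sub>\<infinity>j. a j * \<xi> (k - j) \<omega>)"

definition partial_sum :: "(int \<Rightarrow> 'a \<Rightarrow> real) \<Rightarrow> nat \<Rightarrow> 'a \<Rightarrow> real" where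
  "partial_sum Y k \<omega> = (\<Sum>j=1..k. Y (int j) \<omega>)"

definition partial_sum_process ::
    "(nat \<Rightarrow> real) \<Rightarrow> (int \<Rightarrow> 'a \<Rightarrow> real) \<Rightarrow> nat \<Rightarrow> 'a \<Rightarrow> real \<Rightarrow> real" where
  "partial_sum_process b Y n \<omega> = (\<lambda>t\<in>{0..1}. partial_sum Y (nat \<lfloor>real n * t\<rfloor>) \<omega> / b n)"

end

theory Submission
  imports Defs
begin

text \<open>Write \<open>S k\<close> for the partial sums of the innovations, \<open>S j k\<close> for those of the innovations delayed by
  \<open>j\<close>, and \<open>A\<close> for the sum of the coefficients. The partial sum of the linear process is the series of
  the \<open>a j * S j k\<close>, so that its difference from \<open>A * S k\<close> is the series of the \<open>a j * (S j k - S k)\<close>. It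
  suffices that the maximum over \<open>k \<le> n\<close> of this difference, divided by \<open>b n\<close>, tends to 0 in
  probability: multiplication by \<open>A\<close> is continuous on paths, so \<open>A\<close> times the partial sum process
  converges weakly to \<open>A\<close> times the limit (\<open>weakly_converges_continuous_mapping\<close>), and Slutsky's lemma
  (\<open>weakly_converges_close\<close>) transfers the limit to the linear process. The space of paths is not
  separable, so Slutsky's lemma is derived from Lipschitz approximations from below of a bounded continuous
  test function, and distances are replaced by measurable bounds.

  Size in probability is measured by the expectation of \<open>min 1\<close> of a nonnegative variable. This is
  subadditive, also for series, so the truncated maximum is bounded in mean by a series over \<open>j\<close> of the
  truncated gaps between delay 0 and delay \<open>j\<close> (\<open>mean_linear_gap_le\<close>). The maximal inequality together
  with stationarity dominates the \<open>j\<close>-th term by \<open>2 * C * \<bar>a j\<bar>\<close>, which is summable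
  (\<open>mean_gap_le_shifted_max\<close>). Hence it suffices that each term tends to 0 for fixed \<open>j\<close>
  (\<open>mean_linear_gap_tendsto_0\<close>).

  By stationarity the gap between delays 0 and \<open>j\<close> costs at most \<open>\<bar>j\<bar>\<close> times the gap between delays
  0 and 1 (\<open>mean_gap_le_steps\<close>). A unit delay changes \<open>S k\<close> by \<open>\<xi> k - \<xi> 0\<close>. After division by \<open>b n\<close>
  the first term is a jump of the partial sum process and the second vanishes. Jumps are bounded by the
  modulus of continuity at a fixed scale, a continuous functional of the path, so they are asymptotically
  bounded by the modulus of the limit, which is small because the limit has continuous paths
  (\<open>mean_gap_1_tendsto_0\<close>).\<close>

section \<open>Weak convergence\<close>

lemma measurable_borel_of_topD:
  assumes X: "X \<in> M \<rightarrow>\<^sub>M borel_of_top T" and f: "continuous_map T euclideanreal f"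
  shows "(\<lambda>\<omega>. f (X \<omega>)) \<in> borel_measurable M"
proof (rule measurable_compose[OF X])
  show "f \<in> borel_measurable (borel_of_top T)"
  proof (rule borel_measurableI)
    fix S :: "real set" assume "open S"
    then have "openin T {x \<in> topspace T. f x \<in> S}"
      using f by (simp add: openin_continuous_map_preimage)
    moreover have "f -` S \<inter> space (borel_of_top T) = {x \<in> topspace T. f x \<in> S}"
      by (auto simp: borel_of_top_def space_measure_of_conv)
    ultimately show "f -` S \<inter> space (borel_of_top T) \<in> sets (borel_of_top T)"
      unfolding borel_of_top_def by (metis (mono_tags, lifting) openin_subset Pow_iff in_measure_of mem_Collect_eq subsetI)
  qed
qed

lemma measurable_borel_of_topI:
  assumes "X \<in> space M \<rightarrow> topspace T"
    and "\<And>U. openin T U \<Longrightarrow> X -` U \<inter> space M \<in> sets M"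
  shows "X \<in> M \<rightarrow>\<^sub>M borel_of_top T"
  unfolding borel_of_top_def
  by (rule measurable_measure_of) (use assms in \<open>auto dest: openin_subset\<close>)

lemma measurable_borel_of_top_space:
  assumes "X \<in> M \<rightarrow>\<^sub>M borel_of_top T" "\<omega> \<in> space M"
  shows "X \<omega> \<in> topspace T"
  using measurable_space[OF assms] by (simp add: borel_of_top_def space_measure_of_conv)

lemma measurable_borel_of_top_compose:
  assumes X: "X \<in> M \<rightarrow>\<^sub>M borel_of_top T" and g: "continuous_map T T' g"
  shows "(\<lambda>\<omega>. g (X \<omega>)) \<in> M \<rightarrow>\<^sub>M borel_of_top T'"
proof (rule measurable_borel_of_topI)
  show "(\<lambda>\<omega>. g (X \<omega>)) \<in> space M \<rightarrow> topspace T'"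
    using measurable_borel_of_top_space[OF X] g by (auto simp: continuous_map_def)
  fix U assume "openin T' U"
  then have "openin T {x \<in> topspace T. g x \<in> U}"
    using g by (simp add: openin_continuous_map_preimage)
  then have "X -` {x \<in> topspace T. g x \<in> U} \<inter> space M \<in> sets M"
    by (intro measurable_sets[OF X])
       (metis (mono_tags, lifting) borel_of_top_def openin_subset Pow_iff in_measure_of mem_Collect_eq subsetI)
  moreover have "X -` {x \<in> topspace T. g x \<in> U} \<inter> space M = (\<lambda>\<omega>. g (X \<omega>)) -` U \<inter> space M"
    using measurable_borel_of_top_space[OF X] by auto
  ultimately show "(\<lambda>\<omega>. g (X \<omega>)) -` U \<inter> space M \<in> sets M" by simp
qed

lemma weakly_converges_continuous_mapping:
  assumes XZ: "weakly_converges T M X Z" and g: "continuous_map T T' g"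
  shows "weakly_converges T' M (\<lambda>n \<omega>. g (X n \<omega>)) (\<lambda>\<omega>. g (Z \<omega>))"
  unfolding weakly_converges_def
proof (intro conjI allI impI)
  fix f :: "_ \<Rightarrow> real" assume f: "continuous_map T' euclideanreal f \<and> bounded (f ` topspace T')"
  have "continuous_map T euclideanreal (f \<circ> g)"
    using f g continuous_map_compose by blast
  moreover have "bounded ((f \<circ> g) ` topspace T)"
    using f g by (auto simp: continuous_map_def image_subset_iff intro: bounded_subset)
  ultimately show "(\<lambda>n. \<integral>\<omega>. f (g (X n \<omega>)) \<partial>M) \<longlonglongrightarrow> (\<integral>\<omega>. f (g (Z \<omega>)) \<partial>M)"
    using XZ[unfolded weakly_converges_def, THEN conjunct2, THEN conjunct2, rule_format, of "f \<circ> g"]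
    by (simp add: comp_def)
qed (use XZ measurable_borel_of_top_compose[OF _ g] in \<open>auto simp: weakly_converges_def\<close>)

lemma openin_mtopology_of:
  "openin (mtopology_of m) U \<longleftrightarrow> U \<subseteq> mspace m \<and> (\<forall>x\<in>U. \<exists>r>0. mball_of m x r \<subseteq> U)"
  unfolding mtopology_of_def mball_of_def
  by (auto simp: Metric_space.openin_mtopology[OF Metric_space_mspace_mdist])

text \<open>The largest function below \<open>f\<close> that is Lipschitz with constant \<open>c\<close> (the infimal convolution of \<open>f\<close>
  with \<open>c\<close> times the distance). For bounded continuous \<open>f\<close> these functions increase to \<open>f\<close> as
  \<open>c \<rightarrow> \<infinity>\<close>. They make Lipschitz test functions sufficient for weak convergence in every metric space, in
  particular in the space of cadlag functions with the supremum distance, which is not separable.\<close>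
definition lipschitz_below :: "'b metric \<Rightarrow> ('b \<Rightarrow> real) \<Rightarrow> real \<Rightarrow> 'b \<Rightarrow> real" where
  "lipschitz_below m f c x = (INF y\<in>mspace m. f y + c * mdist m x y)"

context
  fixes m :: "'b metric" and f :: "'b \<Rightarrow> real" and B :: real
  assumes bdd: "\<And>x. x \<in> mspace m \<Longrightarrow> \<bar>f x\<bar> \<le> B"
begin

lemma lipschitz_below_bdd:
  assumes "c \<ge> 0"
  shows "bdd_below ((\<lambda>y. f y + c * mdist m x y) ` mspace m)"
proof (rule bdd_belowI2)
  fix y assume "y \<in> mspace m"
  then show "- B \<le> f y + c * mdist m x y"
    using bdd[of y] assms by (smt (verit) mdist_nonneg mult_nonneg_nonneg)
qed

lemma lipschitz_below_le:
  assumes "c \<ge> 0" "x \<in> mspace m"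
  shows "lipschitz_below m f c x \<le> f x"
  unfolding lipschitz_below_def
  using cINF_lower[OF lipschitz_below_bdd[OF assms(1), of x] assms(2)] mdist_zero[OF assms(2) assms(2)] by simp

lemma lipschitz_below_ge:
  assumes "c \<ge> 0" "x \<in> mspace m"
  shows "- B \<le> lipschitz_below m f c x"
  unfolding lipschitz_below_def
proof (rule cINF_greatest)
  fix y assume "y \<in> mspace m"
  then show "- B \<le> f y + c * mdist m x y"
    using bdd[of y] assms by (smt (verit) mdist_nonneg mult_nonneg_nonneg)
qed (use assms in auto)

lemma lipschitz_below_abs_le:
  assumes "c \<ge> 0" "x \<in> mspace m"
  shows "\<bar>lipschitz_below m f c x\<bar> \<le> B"
  using lipschitz_below_le[OF assms] lipschitz_below_ge[OF assms] bdd[OF assms(2)] by linarith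

lemma lipschitz_below_lipschitz:
  assumes "c \<ge> 0" "x \<in> mspace m" "y \<in> mspace m"
  shows "lipschitz_below m f c x \<le> lipschitz_below m f c y + c * mdist m x y"
proof -
  have "lipschitz_below m f c x - c * mdist m x y \<le> lipschitz_below m f c y"
    unfolding lipschitz_below_def[of m f c y]
  proof (rule cINF_greatest)
    fix z assume z: "z \<in> mspace m"
    have "lipschitz_below m f c x \<le> f z + c * mdist m x z"
      unfolding lipschitz_below_def by (rule cINF_lower[OF lipschitz_below_bdd[OF assms(1)] z])
    also have "c * mdist m x z \<le> c * (mdist m x y + mdist m y z)"
      using assms z by (intro mult_left_mono mdist_triangle) auto
    finally show "lipschitz_below m f c x - c * mdist m x y \<le> f z + c * mdist m y z"
      by (simp add: algebra_simps)
  qed (use assms in auto)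
  then show ?thesis by simp
qed

text \<open>In the infimum that defines the approximation at \<open>x\<close>, points near \<open>x\<close> contribute almost \<open>f x\<close> by
  continuity, and points at distance at least \<open>d\<close> contribute at least \<open>- B + k * d\<close>, which exceeds \<open>B\<close>
  once \<open>k * d\<close> exceeds \<open>2 * B\<close>.\<close>
lemma lipschitz_below_tendsto:
  assumes f: "continuous_map (mtopology_of m) euclideanreal f" and x: "x \<in> mspace m"
  shows "(\<lambda>k. lipschitz_below m f (real k) x) \<longlonglongrightarrow> f x"
proof (rule LIMSEQ_I)
  fix e :: real assume "e > 0"
  then have "\<exists>d>0. \<forall>y\<in>mspace m. mdist m x y < d \<longrightarrow> \<bar>f x - f y\<bar> < e/2"
  proof -
    have "openin (mtopology_of m) {y \<in> mspace m. f y \<in> ball (f x) (e/2)}"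
      using openin_continuous_map_preimage[OF f, of "ball (f x) (e/2)"] by simp
    then obtain d where "d > 0" "mball_of m x d \<subseteq> {y \<in> mspace m. f y \<in> ball (f x) (e/2)}"
      using x \<open>e > 0\<close> by (auto simp: openin_mtopology_of)
    then show ?thesis
      using x by (intro exI[of _ d]) (force simp: dist_real_def)
  qed
  then obtain d where d: "d > 0" "\<And>y. y \<in> mspace m \<Longrightarrow> mdist m x y < d \<Longrightarrow> \<bar>f x - f y\<bar> < e/2"
    by blast
  obtain N :: nat where N: "real N * d \<ge> 2 * B"
    using d(1) by (metis ex_less_of_nat_mult less_imp_le)
  show "\<exists>no. \<forall>k\<ge>no. norm (lipschitz_below m f (real k) x - f x) < e"
  proof (intro exI[of _ N] allI impI)
    fix k assume k: "N \<le> k"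
    have "f x - e/2 \<le> lipschitz_below m f (real k) x"
      unfolding lipschitz_below_def
    proof (rule cINF_greatest)
      fix y assume y: "y \<in> mspace m"
      show "f x - e/2 \<le> f y + real k * mdist m x y"
      proof (cases "mdist m x y < d")
        case True
        then show ?thesis using d(2)[OF y True] by (smt (verit) mdist_nonneg mult_nonneg_nonneg of_nat_0_le_iff)
      next
        case False
        then have "real N * d \<le> real k * mdist m x y"
          using k d(1) by (intro mult_mono) auto
        then show ?thesis using N bdd[OF x] bdd[OF y] \<open>e > 0\<close> by linarith
      qed
    qed (use x in auto)
    then show "norm (lipschitz_below m f (real k) x - f x) < e"
      using lipschitz_below_le[of "real k", OF _ x] \<open>e > 0\<close> by simp
  qed
qed

end

lemma lipschitz_imp_continuous_map_real:
  fixes g :: "'b \<Rightarrow> real"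
  assumes "\<And>x y. x \<in> mspace m \<Longrightarrow> y \<in> mspace m \<Longrightarrow> g x \<le> g y + c * mdist m x y"
  shows "continuous_map (mtopology_of m) euclideanreal g"
proof -
  have "Lipschitz_continuous_map m euclidean_metric g"
    unfolding Lipschitz_continuous_map_def
  proof (intro conjI exI[of _ c] ballI)
    fix x y assume "x \<in> mspace m" "y \<in> mspace m"
    then show "mdist euclidean_metric (g x) (g y) \<le> c * mdist m x y"
      using assms[of x y] assms[of y x] by (simp add: dist_real_def mdist_commute abs_le_iff)
  qed auto
  then show ?thesis using Lipschitz_continuous_imp_continuous_map by fastforce
qed

lemma (in finite_measure) integrable_bounded_real:
  fixes g :: "'a \<Rightarrow> real"
  assumes "g \<in> borel_measurable M" "\<And>x. x \<in> space M \<Longrightarrow> \<bar>g x\<bar> \<le> B"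
  shows "integrable M g"
  by (rule integrable_const_bound[of _ B]) (use assms in auto)

text \<open>The expectation of \<open>f\<close> at \<open>Z\<close> is nearly that of a Lipschitz function \<open>F\<close> below \<open>f\<close>, hence nearly that of
  \<open>F\<close> at \<open>X n\<close>. Being Lipschitz and bounded, \<open>F\<close> changes by at most a constant times \<open>min 1 (T n)\<close> when
  \<open>X n\<close> is replaced by \<open>Y n\<close>, and \<open>F\<close> at \<open>Y n\<close> is at most \<open>f\<close> at \<open>Y n\<close>.\<close>
lemma (in prob_space) weakly_converges_liminf:
  fixes T :: "nat \<Rightarrow> 'a \<Rightarrow> real" and f :: "'b \<Rightarrow> real"
  assumes XZ: "weakly_converges (mtopology_of m) M X Z"
    and Y: "\<And>n. Y n \<in> M \<rightarrow>\<^sub>M borel_of_top (mtopology_of m)"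
    and T: "\<And>n. T n \<in> borel_measurable M" "\<And>n \<omega>. \<omega> \<in> space M \<Longrightarrow> 0 \<le> T n \<omega>"
    and close: "eventually (\<lambda>n. AE \<omega> in M. mdist m (X n \<omega>) (Y n \<omega>) \<le> T n \<omega>) sequentially"
    and T0: "(\<lambda>n. \<integral>\<omega>. min 1 (T n \<omega>) \<partial>M) \<longlonglongrightarrow> 0"
    and f: "continuous_map (mtopology_of m) euclideanreal f"
    and bdd: "\<And>x. x \<in> mspace m \<Longrightarrow> \<bar>f x\<bar> \<le> B"
    and e: "e > 0"
  shows "eventually (\<lambda>n. (\<integral>\<omega>. f (Z \<omega>) \<partial>M) - e < (\<integral>\<omega>. f (Y n \<omega>) \<partial>M)) sequentially"
proof -
  have X: "\<And>n. X n \<in> M \<rightarrow>\<^sub>M borel_of_top (mtopology_of m)"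
    and Z: "Z \<in> M \<rightarrow>\<^sub>M borel_of_top (mtopology_of m)"
    using XZ by (auto simp: weakly_converges_def)
  define F where "F k = lipschitz_below m f (real k)" for k :: nat
  have Fc: "continuous_map (mtopology_of m) euclideanreal (F k)" for k
    unfolding F_def by (rule lipschitz_imp_continuous_map_real[of _ _ "real k"], rule lipschitz_below_lipschitz[OF bdd]) auto
  have Fb: "\<bar>F k x\<bar> \<le> B" if "x \<in> mspace m" for k x
    unfolding F_def by (rule lipschitz_below_abs_le[OF bdd]) (use that in auto)
  have Xs: "X n \<omega> \<in> mspace m" and Ys: "Y n \<omega> \<in> mspace m" and Zs: "Z \<omega> \<in> mspace m"
    if "\<omega> \<in> space M" for n \<omega>
    using measurable_borel_of_top_space[OF X that] measurable_borel_of_top_space[OF Y that]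
       measurable_borel_of_top_space[OF Z that] by auto
  note meas = measurable_borel_of_topD[OF X] measurable_borel_of_topD[OF Y] measurable_borel_of_topD[OF Z]
  have int: "integrable M (\<lambda>\<omega>. F k (X n \<omega>))" "integrable M (\<lambda>\<omega>. F k (Y n \<omega>))" "integrable M (\<lambda>\<omega>. F k (Z \<omega>))"
     "integrable M (\<lambda>\<omega>. f (Y n \<omega>))" "integrable M (\<lambda>\<omega>. f (Z \<omega>))" for n k
    using meas Fc f Fb bdd Xs Ys Zs by (auto intro!: integrable_bounded_real[where B=B])
  have "(\<lambda>k. \<integral>\<omega>. F k (Z \<omega>) \<partial>M) \<longlonglongrightarrow> (\<integral>\<omega>. f (Z \<omega>) \<partial>M)"
  proof (rule integral_dominated_convergence[where w="\<lambda>_. B"])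
    show "AE \<omega> in M. (\<lambda>k. F k (Z \<omega>)) \<longlonglongrightarrow> f (Z \<omega>)"
      unfolding F_def using lipschitz_below_tendsto[OF bdd f] Zs by auto
  qed (use Fb Zs Fc f meas in auto)
  then have "eventually (\<lambda>k. (\<integral>\<omega>. f (Z \<omega>) \<partial>M) - e/3 < (\<integral>\<omega>. F k (Z \<omega>) \<partial>M)) sequentially"
    using e by (intro order_tendstoD) auto
  then obtain k where k: "(\<integral>\<omega>. f (Z \<omega>) \<partial>M) - e/3 < (\<integral>\<omega>. F k (Z \<omega>) \<partial>M)"
    by (auto simp: eventually_sequentially)
  have "(\<lambda>n. \<integral>\<omega>. F k (X n \<omega>) \<partial>M) \<longlonglongrightarrow> (\<integral>\<omega>. F k (Z \<omega>) \<partial>M)"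
    using XZ Fc[of k] Fb[of _ k] unfolding weakly_converges_def by (force simp: bounded_iff)
  then have e1: "eventually (\<lambda>n. (\<integral>\<omega>. F k (Z \<omega>) \<partial>M) - e/3 < (\<integral>\<omega>. F k (X n \<omega>) \<partial>M)) sequentially"
    using e by (intro order_tendstoD) auto
  \<comment> \<open>The Lipschitz constant controls small distances, the bound 2 * B the others.\<close>
  define L where "L = max (real k) (2 * B)"
  have "(\<lambda>n. L * (\<integral>\<omega>. min 1 (T n \<omega>) \<partial>M)) \<longlonglongrightarrow> L * 0"
    by (intro tendsto_intros T0)
  then have e2: "eventually (\<lambda>n. L * (\<integral>\<omega>. min 1 (T n \<omega>) \<partial>M) < e/3) sequentially"
    using e by (intro order_tendstoD) auto
  show ?thesis
    using close e1 e2
  proof eventually_elim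
    case (elim n)
    have intT: "integrable M (\<lambda>\<omega>. min 1 (T n \<omega>))"
      using T by (intro integrable_bounded_real[where B=1]) auto
    have "(\<integral>\<omega>. F k (X n \<omega>) \<partial>M) \<le> (\<integral>\<omega>. f (Y n \<omega>) + L * min 1 (T n \<omega>) \<partial>M)"
    proof (rule integral_mono_AE)
      show "AE \<omega> in M. F k (X n \<omega>) \<le> f (Y n \<omega>) + L * min 1 (T n \<omega>)"
        using elim(1) AE_space
      proof eventually_elim
        case (elim \<omega>)
        note s = Xs[OF elim(2), of n] Ys[OF elim(2), of n]
        have a: "F k (Y n \<omega>) \<le> f (Y n \<omega>)"
          unfolding F_def using lipschitz_below_le[where f=f, OF bdd] s by auto
        have "F k (X n \<omega>) \<le> F k (Y n \<omega>) + real k * mdist m (X n \<omega>) (Y n \<omega>)"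
          unfolding F_def using lipschitz_below_lipschitz[where f=f, OF bdd] s by auto
        also have "real k * mdist m (X n \<omega>) (Y n \<omega>) \<le> L * T n \<omega>"
          using elim(1) by (intro mult_mono) (auto simp: L_def)
        finally have b: "F k (X n \<omega>) \<le> F k (Y n \<omega>) + L * T n \<omega>" by simp
        have "F k (X n \<omega>) \<le> F k (Y n \<omega>) + L"
          using Fb[OF s(1), of k] Fb[OF s(2), of k] by (auto simp: L_def)
        then show ?case using a b by (auto simp: min_def)
      qed
    qed (use int intT in auto)
    also have "\<dots> = (\<integral>\<omega>. f (Y n \<omega>) \<partial>M) + L * (\<integral>\<omega>. min 1 (T n \<omega>) \<partial>M)"
      using int intT by simp
    finally show ?case using elim k by linarith
  qed
qed

text \<open>Slutsky's lemma. Convergence to zero in probability is expressed by the expectation of \<open>min 1 (T n)\<close>,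
  where \<open>T n\<close> is a measurable bound for the distance: in a non-separable space the distance of two random
  elements can fail to be measurable. The lower bound on the limit inferior, applied to \<open>f\<close> and to its
  negative, gives the limit.\<close>
lemma (in prob_space) weakly_converges_close:
  fixes T :: "nat \<Rightarrow> 'a \<Rightarrow> real"
  assumes XZ: "weakly_converges (mtopology_of m) M X Z"
    and Y: "\<And>n. Y n \<in> M \<rightarrow>\<^sub>M borel_of_top (mtopology_of m)"
    and T: "\<And>n. T n \<in> borel_measurable M" "\<And>n \<omega>. \<omega> \<in> space M \<Longrightarrow> 0 \<le> T n \<omega>"
    and close: "eventually (\<lambda>n. AE \<omega> in M. mdist m (X n \<omega>) (Y n \<omega>) \<le> T n \<omega>) sequentially"
    and T0: "(\<lambda>n. \<integral>\<omega>. min 1 (T n \<omega>) \<partial>M) \<longlonglongrightarrow> 0"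
  shows "weakly_converges (mtopology_of m) M Y Z"
  unfolding weakly_converges_def
proof (intro conjI allI impI)
  fix f :: "'b \<Rightarrow> real"
  assume f: "continuous_map (mtopology_of m) euclideanreal f \<and> bounded (f ` topspace (mtopology_of m))"
  then obtain B where B: "\<And>x. x \<in> mspace m \<Longrightarrow> \<bar>f x\<bar> \<le> B"
    by (auto simp: bounded_iff)
  note * = weakly_converges_liminf[OF XZ Y T close T0]
  show "(\<lambda>n. \<integral>\<omega>. f (Y n \<omega>) \<partial>M) \<longlonglongrightarrow> (\<integral>\<omega>. f (Z \<omega>) \<partial>M)"
  proof (rule tendstoI)
    fix e :: real assume e: "e > 0"
    have 1: "eventually (\<lambda>n. (\<integral>\<omega>. f (Z \<omega>) \<partial>M) - e < (\<integral>\<omega>. f (Y n \<omega>) \<partial>M)) sequentially"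
      using * f B e by blast
    have "continuous_map (mtopology_of m) euclideanreal (\<lambda>x. - f x)"
      using f by (auto intro: continuous_intros)
    then have 2: "eventually (\<lambda>n. (\<integral>\<omega>. - f (Z \<omega>) \<partial>M) - e < (\<integral>\<omega>. - f (Y n \<omega>) \<partial>M)) sequentially"
      using B e by (intro *[where B=B]) auto
    show "eventually (\<lambda>n. dist (\<integral>\<omega>. f (Y n \<omega>) \<partial>M) (\<integral>\<omega>. f (Z \<omega>) \<partial>M) < e) sequentially"
      using 1 2 by eventually_elim (auto simp: dist_real_def)
  qed
qed (use XZ Y in \<open>auto simp: weakly_converges_def\<close>)

section \<open>Paths on the unit interval\<close>

lemma mspace_D_unit:
  "f \<in> mspace D_unit \<longleftrightarrow>
     f \<in> extensional {0..1} \<and> bounded (f ` {0..1}) \<and> cadlag_on_unit f"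
  by (auto simp: D_unit_def Met_TC.fspace_def)

lemma mdist_D_unit:
  assumes "f \<in> mspace D_unit" "g \<in> mspace D_unit"
  shows "mdist D_unit f g = (SUP t\<in>{0..1}. \<bar>f t - g t\<bar>)"
  using assms by (simp add: D_unit_def Met_TC.fdist_def dist_real_def)

lemma mdist_D_unit_ge:
  assumes "f \<in> mspace D_unit" "g \<in> mspace D_unit" "t \<in> {0..1}"
  shows "\<bar>f t - g t\<bar> \<le> mdist D_unit f g"
proof -
  have "bounded ((\<lambda>t. f t - g t) ` {0..1})"
    using assms by (intro bounded_minus_comp) (auto simp: mspace_D_unit)
  then have "bdd_above ((\<lambda>t. \<bar>f t - g t\<bar>) ` {0..1})"
    by (auto simp: bounded_iff bdd_above_def)
  then show ?thesis
    unfolding mdist_D_unit[OF assms(1,2)] by (rule cSUP_upper[OF assms(3)])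
qed

lemma mdist_D_unit_le:
  assumes "f \<in> mspace D_unit" "g \<in> mspace D_unit" "\<And>t. t \<in> {0..1} \<Longrightarrow> \<bar>f t - g t\<bar> \<le> c"
  shows "mdist D_unit f g \<le> c"
  unfolding mdist_D_unit[OF assms(1,2)] by (rule cSUP_least) (use assms in auto)

lemma cadlag_on_unit_cong:
  assumes "\<And>t. t \<in> {0..1} \<Longrightarrow> f t = g t"
  shows "cadlag_on_unit f \<longleftrightarrow> cadlag_on_unit g"
proof -
  have r: "eventually (\<lambda>s. f s = g s) (at_right t)" if "t \<in> {0..<1}" for t
    using that by (auto simp: eventually_at_right_field intro!: assms exI[of _ 1])
  have l: "eventually (\<lambda>s. f s = g s) (at_left t)" if "t \<in> {0<..1}" for t
    using that by (auto simp: eventually_at_left_field intro!: assms exI[of _ 0])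
  have "(f \<longlongrightarrow> f t) (at_right t) \<longleftrightarrow> (g \<longlongrightarrow> g t) (at_right t)" if "t \<in> {0..<1}" for t
    using tendsto_cong[OF r[OF that]] assms[of t] that by simp
  moreover have "(f \<longlongrightarrow> c) (at_left t) \<longleftrightarrow> (g \<longlongrightarrow> c) (at_left t)" if "t \<in> {0<..1}" for t c
    using tendsto_cong[OF l[OF that]] .
  ultimately show ?thesis unfolding cadlag_on_unit_def by simp
qed

lemma cadlag_on_unit_cmult:
  assumes "cadlag_on_unit f"
  shows "cadlag_on_unit (\<lambda>t. c * f t)"
  using assms unfolding cadlag_on_unit_def by (blast intro: tendsto_mult_left)

definition scale_path :: "real \<Rightarrow> (real \<Rightarrow> real) \<Rightarrow> real \<Rightarrow> real" where
  "scale_path c x = (\<lambda>t\<in>{0..1}. c * x t)"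

lemma scale_path_in_D_unit:
  assumes "x \<in> mspace D_unit"
  shows "scale_path c x \<in> mspace D_unit"
proof -
  have "cadlag_on_unit (scale_path c x) \<longleftrightarrow> cadlag_on_unit (\<lambda>t. c * x t)"
    by (rule cadlag_on_unit_cong) (simp add: scale_path_def)
  moreover have "bounded ((\<lambda>y. c * y) ` x ` {0..1})"
    using assms bounded_scaling[of "x ` {0..1}" c] by (simp add: mspace_D_unit)
  then have "bounded (scale_path c x ` {0..1})"
    by (simp add: scale_path_def image_image)
  ultimately show ?thesis
    using assms by (simp add: mspace_D_unit cadlag_on_unit_cmult) (simp add: scale_path_def)
qed

lemma continuous_map_scale_path:
  "continuous_map (mtopology_of D_unit) (mtopology_of D_unit) (scale_path c)"
proof (rule Lipschitz_continuous_imp_continuous_map)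
  show "Lipschitz_continuous_map D_unit D_unit (scale_path c)"
    unfolding Lipschitz_continuous_map_def
  proof (intro conjI exI[of _ "\<bar>c\<bar>"] ballI)
    fix x y assume xy: "x \<in> mspace D_unit" "y \<in> mspace D_unit"
    show "mdist D_unit (scale_path c x) (scale_path c y) \<le> \<bar>c\<bar> * mdist D_unit x y"
    proof (rule mdist_D_unit_le)
      fix t :: real assume t: "t \<in> {0..1}"
      have "\<bar>scale_path c x t - scale_path c y t\<bar> = \<bar>c\<bar> * \<bar>x t - y t\<bar>"
        using t by (simp add: scale_path_def abs_mult flip: right_diff_distrib)
      also have "\<dots> \<le> \<bar>c\<bar> * mdist D_unit x y"
        by (intro mult_left_mono mdist_D_unit_ge xy t) auto
      finally show "\<bar>scale_path c x t - scale_path c y t\<bar> \<le> \<bar>c\<bar> * mdist D_unit x y" .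
    qed (use xy scale_path_in_D_unit in auto)
  qed (auto intro: scale_path_in_D_unit)
qed

text \<open>Partial sum processes are the step paths through the values \<open>v 0, \<dots>, v n\<close>, so that a bound between
  finitely many values becomes a bound in supremum distance.\<close>
definition step_path :: "nat \<Rightarrow> (nat \<Rightarrow> real) \<Rightarrow> real \<Rightarrow> real" where
  "step_path n v = (\<lambda>t\<in>{0..1}. v (nat \<lfloor>real n * t\<rfloor>))"

lemma nat_floor_le:
  assumes "t \<le> 1"
  shows "nat \<lfloor>real n * t\<rfloor> \<le> n"
proof -
  have "real n * t \<le> real n * 1" using assms by (intro mult_left_mono) auto
  then have "\<lfloor>real n * t\<rfloor> \<le> int n" by (simp add: floor_le_iff)
  then show ?thesis by simp
qed

lemma cadlag_step_path: "cadlag_on_unit (step_path n v)"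
proof -
  have "cadlag_on_unit (\<lambda>t. v (nat \<lfloor>real n * t\<rfloor>))"
  proof (cases "n = 0")
    case True
    then show ?thesis by (auto simp: cadlag_on_unit_def)
  next
    case False
    have "((\<lambda>t. v (nat \<lfloor>real n * t\<rfloor>)) \<longlongrightarrow> v (nat \<lfloor>real n * t\<rfloor>)) (at_right t)" for t
    proof (rule tendsto_eventually, unfold eventually_at_right_field, intro exI conjI allI impI)
      show "t < (real_of_int \<lfloor>real n * t\<rfloor> + 1) / real n"
        using False by (simp add: pos_less_divide_eq mult.commute)
      fix s assume s: "t < s" "s < (real_of_int \<lfloor>real n * t\<rfloor> + 1) / real n"
      have "real n * t \<le> real n * s" using s by (intro mult_left_mono) auto
      moreover have "real n * s < real_of_int \<lfloor>real n * t\<rfloor> + 1"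
        using s(2) False by (simp add: pos_less_divide_eq mult.commute)
      ultimately have "\<lfloor>real n * s\<rfloor> = \<lfloor>real n * t\<rfloor>" by linarith
      then show "v (nat \<lfloor>real n * s\<rfloor>) = v (nat \<lfloor>real n * t\<rfloor>)" by simp
    qed
    moreover have "((\<lambda>t. v (nat \<lfloor>real n * t\<rfloor>)) \<longlongrightarrow> v (nat (\<lceil>real n * t\<rceil> - 1))) (at_left t)" for t
    proof (rule tendsto_eventually, unfold eventually_at_left_field, intro exI conjI allI impI)
      show "(real_of_int \<lceil>real n * t\<rceil> - 1) / real n < t"
        using False by (simp add: pos_divide_less_eq mult.commute) linarith
      fix s assume s: "s < t" "(real_of_int \<lceil>real n * t\<rceil> - 1) / real n < s"
      have "real n * s < real n * t" using s False by (intro mult_strict_left_mono) auto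
      moreover have "real_of_int \<lceil>real n * t\<rceil> - 1 < real n * s"
        using s(2) False by (simp add: pos_divide_less_eq mult.commute)
      ultimately have "\<lfloor>real n * s\<rfloor> = \<lceil>real n * t\<rceil> - 1" by linarith
      then show "v (nat \<lfloor>real n * s\<rfloor>) = v (nat (\<lceil>real n * t\<rceil> - 1))" by simp
    qed
    ultimately show ?thesis unfolding cadlag_on_unit_def by blast
  qed
  then show ?thesis
    using cadlag_on_unit_cong[of "step_path n v" "\<lambda>t. v (nat \<lfloor>real n * t\<rfloor>)"] by (simp add: step_path_def)
qed

lemma step_path_in_D_unit: "step_path n v \<in> mspace D_unit"
proof -
  have "step_path n v ` {0..1} \<subseteq> v ` {..n}"
    by (auto simp: step_path_def intro!: imageI nat_floor_le)
  then have "bounded (step_path n v ` {0..1})"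
    by (meson finite_atMost finite_imageI finite_imp_bounded bounded_subset)
  then show ?thesis
    using cadlag_step_path by (simp add: mspace_D_unit) (simp add: step_path_def)
qed

lemma mdist_step_path_le:
  assumes "\<And>k. k \<le> n \<Longrightarrow> \<bar>v k - u k\<bar> \<le> c"
  shows "mdist D_unit (step_path n v) (step_path n u) \<le> c"
proof (rule mdist_D_unit_le)
  fix t :: real assume t: "t \<in> {0..1}"
  then show "\<bar>step_path n v t - step_path n u t\<bar> \<le> c"
    using assms[OF nat_floor_le[of t n]] by (simp add: step_path_def)
qed (rule step_path_in_D_unit)+

text \<open>The Borel sigma-field of the supremum distance is larger than the one generated by the coordinates, so
  measurability does not follow coordinate by coordinate. It holds because \<open>step_path n\<close> is continuous
  on the sequence space with the product topology, whose Borel sets are generated by the coordinates.\<close>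
lemma measurable_step_path:
  assumes V: "\<And>k. V k \<in> borel_measurable M"
  shows "(\<lambda>\<omega>. step_path n (\<lambda>k. V k \<omega>)) \<in> M \<rightarrow>\<^sub>M borel_of_top (mtopology_of D_unit)"
proof (rule measurable_borel_of_topI)
  fix U assume U: "openin (mtopology_of D_unit) U"
  have "open (step_path n -` U)"
  proof (subst open_subopen, intro ballI)
    fix v assume "v \<in> step_path n -` U"
    then obtain r where r: "r > 0" "mball_of D_unit (step_path n v) r \<subseteq> U"
      using U by (auto simp: openin_mtopology_of)
    define V' where "V' = {u :: nat \<Rightarrow> real. (\<Sum>k\<le>n. \<bar>v k - u k\<bar>) < r}"
    have "open V'"
      unfolding V'_def by (intro open_Collect_less continuous_intros continuous_on_product_coordinates)
    moreover have "v \<in> V'" using r by (simp add: V'_def)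
    moreover have "V' \<subseteq> step_path n -` U"
    proof
      fix u assume u: "u \<in> V'"
      have "mdist D_unit (step_path n v) (step_path n u) \<le> (\<Sum>k\<le>n. \<bar>v k - u k\<bar>)"
        by (rule mdist_step_path_le) (auto intro!: member_le_sum[of _ "{..n}" "\<lambda>k. \<bar>v k - u k\<bar>"])
      then have "step_path n u \<in> mball_of D_unit (step_path n v) r"
        using u step_path_in_D_unit by (simp add: V'_def)
      then show "u \<in> step_path n -` U" using r by auto
    qed
    ultimately show "\<exists>T. open T \<and> v \<in> T \<and> T \<subseteq> step_path n -` U" by blast
  qed
  moreover have "(\<lambda>\<omega> k. V k \<omega>) \<in> borel_measurable M"
    by (rule measurable_coordinatewise_then_product) (rule V)
  ultimately have "(\<lambda>\<omega> k. V k \<omega>) -` (step_path n -` U) \<inter> space M \<in> sets M"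
    by (metis borel_open measurable_sets)
  then show "(\<lambda>\<omega>. step_path n (\<lambda>k. V k \<omega>)) -` U \<inter> space M \<in> sets M"
    by (simp add: vimage_def)
qed (simp add: step_path_in_D_unit)

text \<open>The modulus of continuity at scale \<open>d\<close>, truncated inside the supremum. The truncation makes the functional
  bounded, hence a legitimate test function for weak convergence; it detects the jumps of a step path.\<close>
definition oscillation :: "real \<Rightarrow> real \<Rightarrow> (real \<Rightarrow> real) \<Rightarrow> real" where
  "oscillation c d x =
     (SUP (s, t) \<in> {(s, t). s \<in> {0..1} \<and> t \<in> {0..1} \<and> \<bar>s - t\<bar> \<le> d}. min 1 (c * \<bar>x s - x t\<bar>))"

lemma oscillation_upper:
  assumes "s \<in> {0..1}" "t \<in> {0..1}" "\<bar>s - t\<bar> \<le> d"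
  shows "min 1 (c * \<bar>x s - x t\<bar>) \<le> oscillation c d x"
proof -
  have "bdd_above ((\<lambda>(s, t). min 1 (c * \<bar>x s - x t\<bar>)) ` {(s, t). s \<in> {0..1} \<and> t \<in> {0..1} \<and> \<bar>s - t\<bar> \<le> d})"
    by (rule bdd_aboveI[of _ 1]) auto
  from cSUP_upper[OF _ this, of "(s, t)"] show ?thesis
    using assms by (simp add: oscillation_def)
qed

lemma oscillation_least:
  assumes "d \<ge> 0"
    and "\<And>s t. s \<in> {0..1} \<Longrightarrow> t \<in> {0..1} \<Longrightarrow> \<bar>s - t\<bar> \<le> d \<Longrightarrow> min 1 (c * \<bar>x s - x t\<bar>) \<le> u"
  shows "oscillation c d x \<le> u"
proof -
  have "(0, 0) \<in> {(s, t). s \<in> {0..1::real} \<and> t \<in> {0..1} \<and> \<bar>s - t\<bar> \<le> d}"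
    using assms(1) by simp
  then show ?thesis
    unfolding oscillation_def by (intro cSUP_least) (use assms(2) in blast, use assms(2) in auto)
qed

lemma oscillation_bounds:
  assumes "d \<ge> 0" "c \<ge> 0"
  shows "0 \<le> oscillation c d x" "oscillation c d x \<le> 1"
  using oscillation_upper[of 0 0 d c x] assms by (auto intro!: oscillation_least)

lemma continuous_map_oscillation:
  assumes "d \<ge> 0" "c \<ge> 0"
  shows "continuous_map (mtopology_of D_unit) euclideanreal (oscillation c d)"
proof (rule lipschitz_imp_continuous_map_real[where c="2 * c"])
  fix x y assume xy: "x \<in> mspace D_unit" "y \<in> mspace D_unit"
  show "oscillation c d x \<le> oscillation c d y + 2 * c * mdist D_unit x y"
  proof (rule oscillation_least[OF assms(1)])
    fix s t :: real assume st: "s \<in> {0..1}" "t \<in> {0..1}" "\<bar>s - t\<bar> \<le> d"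
    have "\<bar>x s - x t\<bar> \<le> \<bar>y s - y t\<bar> + 2 * mdist D_unit x y"
      using mdist_D_unit_ge[OF xy st(1)] mdist_D_unit_ge[OF xy st(2)] by linarith
    then have "c * \<bar>x s - x t\<bar> \<le> c * (\<bar>y s - y t\<bar> + 2 * mdist D_unit x y)"
      using assms by (intro mult_left_mono)
    then have "min 1 (c * \<bar>x s - x t\<bar>) \<le> min 1 (c * \<bar>y s - y t\<bar>) + 2 * c * mdist D_unit x y"
      using mult_nonneg_nonneg[OF assms(2) mdist_nonneg[of D_unit x y]]
      by (simp add: algebra_simps min_def)
    also have "min 1 (c * \<bar>y s - y t\<bar>) \<le> oscillation c d y"
      by (rule oscillation_upper[OF st])
    finally show "min 1 (c * \<bar>x s - x t\<bar>) \<le> oscillation c d y + 2 * c * mdist D_unit x y" by simp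
  qed
qed

lemma oscillation_tendsto_0:
  assumes "continuous_on {0..1} x" "c \<ge> 0"
  shows "(\<lambda>m. oscillation c (1 / real (Suc m)) x) \<longlonglongrightarrow> 0"
proof (rule LIMSEQ_I)
  fix e :: real assume e: "e > 0"
  have "uniformly_continuous_on {0..1} x"
    using assms by (intro compact_uniformly_continuous) auto
  then obtain d where d: "d > 0" "\<And>s t. s \<in> {0..1} \<Longrightarrow> t \<in> {0..1} \<Longrightarrow> dist t s < d \<Longrightarrow> dist (x t) (x s) < e / 2 / (c + 1)"
    using e assms unfolding uniformly_continuous_on_def by (metis divide_pos_pos half_gt_zero add_nonneg_pos zero_less_one)
  obtain N where N: "1 / real (Suc N) < d" using d(1) nat_approx_posE by blast
  show "\<exists>no. \<forall>m\<ge>no. norm (oscillation c (1 / real (Suc m)) x - 0) < e"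
  proof (intro exI[of _ N] allI impI)
    fix m assume m: "N \<le> m"
    have "oscillation c (1 / real (Suc m)) x \<le> e / 2"
    proof (rule oscillation_least)
      fix s t :: real assume st: "s \<in> {0..1}" "t \<in> {0..1}" "\<bar>s - t\<bar> \<le> 1 / real (Suc m)"
      have "1 / real (Suc m) \<le> 1 / real (Suc N)" using m by (simp add: frac_le)
      then have "\<bar>x s - x t\<bar> < e / 2 / (c + 1)"
        using d(2)[of t s] st N by (simp add: dist_real_def)
      then have "c * \<bar>x s - x t\<bar> \<le> (c + 1) * (e / 2 / (c + 1))"
        using assms e by (intro mult_mono) auto
      also have "\<dots> = e / 2" using assms by (simp add: field_simps)
      finally show "min 1 (c * \<bar>x s - x t\<bar>) \<le> e / 2" by simp
    qed auto
    then show "norm (oscillation c (1 / real (Suc m)) x - 0) < e"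
      using e oscillation_bounds(1)[of "1 / real (Suc m)" c x] assms by simp
  qed
qed

section \<open>Series as integrals over the counting measure\<close>

text \<open>The equation holds for every \<open>f\<close>: for real families summability is absolute summability, and
  both sides are 0 when it fails. Integrals bring measurability of the series in a parameter and Fubini's
  theorem.\<close>
lemma infsum_eq_lebesgue_count_space:
  fixes f :: "'b \<Rightarrow> real"
  shows "(\<Sum>\<^sub>\<infinity>j. f j) = (\<integral>j. f j \<partial>count_space UNIV)"
proof (cases "integrable (count_space UNIV) f")
  case True
  then have "Infinite_Set_Sum.abs_summable_on f UNIV"
    by (simp add: Infinite_Set_Sum.abs_summable_on_def)
  then show ?thesis
    by (simp add: infsetsum_infsum[symmetric] infsetsum_def)
next
  case False
  then have "\<not> f summable_on UNIV"
    using abs_summable_equivalent[of f UNIV] summable_on_iff_abs_summable_on_real[of f UNIV]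
    by (simp add: Infinite_Set_Sum.abs_summable_on_def)
  then show ?thesis
    using False by (simp add: infsum_not_exists not_integrable_integral_eq)
qed

lemma integrable_count_space_iff_abs_summable:
  fixes f :: "'b \<Rightarrow> real"
  shows "integrable (count_space UNIV) f \<longleftrightarrow> (\<lambda>j. \<bar>f j\<bar>) summable_on UNIV"
  using abs_summable_equivalent[of f UNIV]
  by (simp add: Infinite_Set_Sum.abs_summable_on_def)

lemma measurable_linear_process:
  assumes [measurable]: "\<And>k. \<xi> k \<in> borel_measurable M"
  shows "linear_process a \<xi> k \<in> borel_measurable M"
proof -
  interpret count: sigma_finite_measure "count_space (UNIV :: int set)"
    by (rule sigma_finite_measure_count_space)
  have "(\<lambda>(\<omega>, j). a j * \<xi> (k - j) \<omega>) \<in> borel_measurable (M \<Otimes>\<^sub>M count_space UNIV)"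
    unfolding case_prod_beta
    by (rule measurable_compose_countable'[where f="\<lambda>j p. a j * \<xi> (k - j) (fst p)" and g=snd and I=UNIV])
       auto
  then have "(\<lambda>\<omega>. \<integral>j. a j * \<xi> (k - j) \<omega> \<partial>count_space UNIV) \<in> borel_measurable M"
    by (rule count.borel_measurable_lebesgue_integral)
  then show ?thesis
    by (simp add: linear_process_def[abs_def] infsum_eq_lebesgue_count_space)
qed

text \<open>Either one term is at least 1, and then so is the right side, or the truncation on the right is void.\<close>
lemma min_1_nn_integral_count_space_le:
  "min 1 (\<integral>\<^sup>+j. f j \<partial>count_space UNIV) \<le> (\<integral>\<^sup>+j. min 1 (f j) \<partial>count_space UNIV)"
proof (cases "\<exists>j. 1 \<le> f j")
  case True
  then obtain j where "1 \<le> f j" by blast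
  then have "1 \<le> (\<integral>\<^sup>+j. min 1 (f j) \<partial>count_space UNIV)"
    using nn_integral_ge_point[of j UNIV "\<lambda>j. min 1 (f j)"] by (simp add: min_def)
  then show ?thesis by (simp add: min.coboundedI1)
next
  case False
  then have "min 1 (f j) = f j" for j by (meson linear min.absorb2)
  then show ?thesis by simp
qed

section \<open>Shifted partial sums\<close>

definition shifted_sum :: "(int \<Rightarrow> real) \<Rightarrow> int \<Rightarrow> nat \<Rightarrow> real" where
  "shifted_sum x j k = (\<Sum>i=1..k. x (int i - j))"

definition shifted_max :: "(int \<Rightarrow> real) \<Rightarrow> nat \<Rightarrow> int \<Rightarrow> real" where
  "shifted_max x n j = (MAX k\<in>{..n}. \<bar>shifted_sum x j k\<bar>)"

text \<open>The linear process is a mixture over \<open>j\<close> of the innovations delayed by \<open>j\<close>. This is the distance, up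
  to time \<open>n\<close>, between the partial sums for two delays.\<close>
definition shift_gap :: "(int \<Rightarrow> real) \<Rightarrow> nat \<Rightarrow> int \<Rightarrow> int \<Rightarrow> real" where
  "shift_gap x n i j = (MAX k\<in>{..n}. \<bar>shifted_sum x i k - shifted_sum x j k\<bar>)"

lemma shift_gap_upper: "k \<le> n \<Longrightarrow> \<bar>shifted_sum x i k - shifted_sum x j k\<bar> \<le> shift_gap x n i j"
  unfolding shift_gap_def by (rule Max_ge) auto

lemma shift_gap_least:
  "(\<And>k. k \<le> n \<Longrightarrow> \<bar>shifted_sum x i k - shifted_sum x j k\<bar> \<le> c) \<Longrightarrow> shift_gap x n i j \<le> c"
  unfolding shift_gap_def by (rule Max.boundedI) auto

lemma shift_gap_nonneg: "0 \<le> shift_gap x n i j"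
  using shift_gap_upper[of 0 n x i j] by simp

lemma shift_gap_self: "shift_gap x n i i = 0"
  using shift_gap_least[of n x i i 0] shift_gap_nonneg[of x n i i] by simp

lemma shift_gap_commute: "shift_gap x n i j = shift_gap x n j i"
  by (simp add: shift_gap_def abs_minus_commute)

lemma shift_gap_triangle: "shift_gap x n i l \<le> shift_gap x n i j + shift_gap x n j l"
proof (rule shift_gap_least)
  fix k assume "k \<le> n"
  then show "\<bar>shifted_sum x i k - shifted_sum x l k\<bar> \<le> shift_gap x n i j + shift_gap x n j l"
    using shift_gap_upper[of k n x i j] shift_gap_upper[of k n x j l] by linarith
qed

lemma shifted_sum_translate: "shifted_sum (\<lambda>k. x (k + m)) j k = shifted_sum x (j - m) k"
  by (simp add: shifted_sum_def algebra_simps)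

lemma shift_gap_le_shifted_max: "shift_gap x n i j \<le> shifted_max x n i + shifted_max x n j"
proof (rule shift_gap_least)
  fix k assume "k \<le> n"
  then have "\<bar>shifted_sum x l k\<bar> \<le> shifted_max x n l" for l
    unfolding shifted_max_def by (intro Max_ge) auto
  from this[of i] this[of j]
  show "\<bar>shifted_sum x i k - shifted_sum x j k\<bar> \<le> shifted_max x n i + shifted_max x n j" by linarith
qed

lemma shifted_sum_diff_1: "shifted_sum x 0 k - shifted_sum x 1 k = x (int k) - x 0"
  by (induction k) (auto simp: shifted_sum_def algebra_simps)

lemma measurable_shifted_sum [measurable]:
  "(\<lambda>x. shifted_sum x j k) \<in> borel_measurable (\<Pi>\<^sub>M k\<in>UNIV. borel)"
  unfolding shifted_sum_def by measurable

lemma measurable_shifted_max [measurable]: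
  "(\<lambda>x. shifted_max x n j) \<in> borel_measurable (\<Pi>\<^sub>M k\<in>UNIV. borel)"
  unfolding shifted_max_def by measurable

lemma measurable_shift_gap [measurable]:
  "(\<lambda>x. shift_gap x n i j) \<in> borel_measurable (\<Pi>\<^sub>M k\<in>UNIV. borel)"
  unfolding shift_gap_def by measurable

text \<open>Delaying by one step changes the \<open>k\<close>-th partial sum by \<open>x k - x 0\<close>. The term \<open>x k\<close> is the jump of the
  partial sum path at \<open>k / n\<close>, seen by the oscillation at any scale \<open>d \<ge> 1 / n\<close> through the two points
  \<open>(k - 1) / n\<close> and \<open>k / n\<close>.\<close>
lemma min_1_shift_gap_le_oscillation:
  fixes x :: "int \<Rightarrow> real"
  assumes "n \<ge> 1" "1 / real n \<le> d" "c \<ge> 0" "\<beta> > 0"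
  shows "min 1 (c / \<beta> * shift_gap x n 0 1)
         \<le> c / \<beta> * \<bar>x 0\<bar> + oscillation c d (step_path n (\<lambda>k. shifted_sum x 0 k / \<beta>))"
proof -
  have "shift_gap x n 0 1 \<in> (\<lambda>k. \<bar>shifted_sum x 0 k - shifted_sum x 1 k\<bar>) ` {..n}"
    unfolding shift_gap_def by (rule Max_in) auto
  then obtain k where k: "k \<le> n" "shift_gap x n 0 1 = \<bar>x (int k) - x 0\<bar>"
    by (auto simp: shifted_sum_diff_1)
  define p where "p = step_path n (\<lambda>k. shifted_sum x 0 k / \<beta>)"
  have d: "d \<ge> 0" using assms by (smt (verit) divide_nonneg_nonneg of_nat_0_le_iff)
  show ?thesis
  proof (cases "k = 0")
    case True
    then show ?thesis
      using k assms d oscillation_bounds(1)[OF d assms(3), of p] by (simp add: p_def)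
  next
    case False
    have fl: "nat \<lfloor>real n * (real l / real n)\<rfloor> = l" for l using assms by simp
    have u: "real l / real n \<in> {0..1}" if "l \<le> n" for l using that assms by simp
    have pl: "p (real l / real n) = shifted_sum x 0 l / \<beta>" if "l \<le> n" for l
      using u[OF that] fl[of l] unfolding p_def step_path_def by simp
    have "shifted_sum x 0 k - shifted_sum x 0 (k - 1) = x (int k)"
      using False by (cases k) (auto simp: shifted_sum_def)
    then have "p (real k / real n) - p (real (k - 1) / real n) = x (int k) / \<beta>"
      using k by (simp add: pl flip: diff_divide_distrib)
    moreover have "\<bar>real k / real n - real (k - 1) / real n\<bar> \<le> d"
      using False assms by (simp add: of_nat_diff flip: diff_divide_distrib)
    ultimately have *: "min 1 (c * \<bar>x (int k) / \<beta>\<bar>) \<le> oscillation c d p"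
      using oscillation_upper[of "real k / real n" "real (k - 1) / real n" d c p] u[of k] u[of "k-1"] k
      by simp
    have "c / \<beta> * shift_gap x n 0 1 \<le> c / \<beta> * (\<bar>x 0\<bar> + \<bar>x (int k)\<bar>)"
      using k assms by (intro mult_left_mono) auto
    also have "\<dots> = c / \<beta> * \<bar>x 0\<bar> + c * \<bar>x (int k) / \<beta>\<bar>"
      using assms by (simp add: algebra_simps)
    finally have "min 1 (c / \<beta> * shift_gap x n 0 1) \<le> c / \<beta> * \<bar>x 0\<bar> + min 1 (c * \<bar>x (int k) / \<beta>\<bar>)"
      using mult_nonneg_nonneg[OF divide_nonneg_pos[OF assms(3,4)] abs_ge_zero[of "x 0"]]
      by linarith
    then show ?thesis using * by (simp add: p_def)
  qed
qed

section \<open>Gaps under stationarity\<close>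

locale stationary_process = prob_space M for M :: "'a measure" +
  fixes \<xi> :: "int \<Rightarrow> 'a \<Rightarrow> real"
  assumes stationary: "stationary_sequence M \<xi>"
begin

lemma measurable_innovation [measurable]: "\<xi> k \<in> borel_measurable M"
  using stationary by (simp add: stationary_sequence_def)

lemma measurable_sequence [measurable]:
  "(\<lambda>\<omega> k. \<xi> (k + m) \<omega>) \<in> M \<rightarrow>\<^sub>M (\<Pi>\<^sub>M k\<in>UNIV. borel)"
  "(\<lambda>\<omega> k. \<xi> k \<omega>) \<in> M \<rightarrow>\<^sub>M (\<Pi>\<^sub>M k\<in>UNIV. borel)"
  by (auto intro!: measurable_PiM_single')

lemma integrable_translate:
  fixes h :: "(int \<Rightarrow> real) \<Rightarrow> real"
  assumes [measurable]: "h \<in> borel_measurable (\<Pi>\<^sub>M k\<in>UNIV. borel)"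
  shows "integrable M (\<lambda>\<omega>. h (\<lambda>k. \<xi> (k + m) \<omega>)) \<longleftrightarrow> integrable M (\<lambda>\<omega>. h (\<lambda>k. \<xi> k \<omega>))"
  using stationary unfolding stationary_sequence_def
  by (subst (1 2) integrable_distr_eq[symmetric, where f=h and N="\<Pi>\<^sub>M k\<in>UNIV. borel"]) auto

lemma expectation_translate:
  fixes h :: "(int \<Rightarrow> real) \<Rightarrow> real"
  assumes [measurable]: "h \<in> borel_measurable (\<Pi>\<^sub>M k\<in>UNIV. borel)"
  shows "expectation (\<lambda>\<omega>. h (\<lambda>k. \<xi> (k + m) \<omega>)) = expectation (\<lambda>\<omega>. h (\<lambda>k. \<xi> k \<omega>))"
  using stationary unfolding stationary_sequence_def
  by (subst (1 2) integral_distr[symmetric, where f=h and N="\<Pi>\<^sub>M k\<in>UNIV. borel"]) auto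

lemma innovation_integrable:
  assumes "integrable M (\<xi> 0)"
  shows "integrable M (\<xi> k)" "expectation (\<lambda>\<omega>. \<bar>\<xi> k \<omega>\<bar>) = expectation (\<lambda>\<omega>. \<bar>\<xi> 0 \<omega>\<bar>)"
  using integrable_translate[of "\<lambda>x. x 0" k] expectation_translate[of "\<lambda>x. \<bar>x 0\<bar>" k] assms by auto

lemma shifted_max_integrable:
  assumes "integrable M (\<xi> 0)"
  shows "integrable M (\<lambda>\<omega>. shifted_max (\<lambda>k. \<xi> k \<omega>) n j)"
proof (rule Bochner_Integration.integrable_bound)
  show "integrable M (\<lambda>\<omega>. \<Sum>k\<le>n. \<bar>shifted_sum (\<lambda>k. \<xi> k \<omega>) j k\<bar>)"
    unfolding shifted_sum_def
    by (intro Bochner_Integration.integrable_sum integrable_abs innovation_integrable(1)[OF assms])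
  have "\<bar>shifted_max x n j\<bar> \<le> (\<Sum>k\<le>n. \<bar>shifted_sum x j k\<bar>)" for x
  proof -
    have "shifted_max x n j \<in> (\<lambda>k. \<bar>shifted_sum x j k\<bar>) ` {..n}"
      unfolding shifted_max_def by (rule Max_in) auto
    then show ?thesis
      by (auto intro!: member_le_sum[of _ "{..n}" "\<lambda>k. \<bar>shifted_sum x j k\<bar>"])
  qed
  then show "AE \<omega> in M. norm (shifted_max (\<lambda>k. \<xi> k \<omega>) n j) \<le> norm (\<Sum>k\<le>n. \<bar>shifted_sum (\<lambda>k. \<xi> k \<omega>) j k\<bar>)"
    by (auto simp: abs_of_nonneg[OF sum_nonneg])
qed measurable

lemma expectation_shifted_max:
  "expectation (\<lambda>\<omega>. shifted_max (\<lambda>k. \<xi> k \<omega>) n j) = expectation (\<lambda>\<omega>. shifted_max (\<lambda>k. \<xi> k \<omega>) n 0)"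
proof -
  have "shifted_max (\<lambda>k. \<xi> (k + j) \<omega>) n j = shifted_max (\<lambda>k. \<xi> k \<omega>) n 0" for \<omega>
    using shifted_sum_translate[of "\<lambda>k. \<xi> k \<omega>" j j] by (simp add: shifted_max_def)
  then show ?thesis
    using expectation_translate[of "\<lambda>x. shifted_max x n j" j] by simp
qed

text \<open>The truncation makes this expectation a measure of size in probability that is subadditive. It is
  therefore a pseudometric on delays, and by stationarity it is invariant under translation.\<close>
definition mean_gap :: "real \<Rightarrow> nat \<Rightarrow> int \<Rightarrow> int \<Rightarrow> real" where
  "mean_gap c n i j = expectation (\<lambda>\<omega>. min 1 (c * shift_gap (\<lambda>k. \<xi> k \<omega>) n i j))"

lemma mean_gap_translate: "mean_gap c n (i - m) (j - m) = mean_gap c n i j"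
proof -
  have "shift_gap (\<lambda>k. \<xi> (k + m) \<omega>) n i j = shift_gap (\<lambda>k. \<xi> k \<omega>) n (i - m) (j - m)" for \<omega>
    using shifted_sum_translate[of "\<lambda>k. \<xi> k \<omega>" m] by (simp add: shift_gap_def)
  then show ?thesis
    using expectation_translate[of "\<lambda>x. min 1 (c * shift_gap x n i j)" m] by (simp add: mean_gap_def)
qed

lemma min_gap_integrable:
  assumes "c \<ge> 0"
  shows "integrable M (\<lambda>\<omega>. min 1 (c * shift_gap (\<lambda>k. \<xi> k \<omega>) n i j))"
  using assms shift_gap_nonneg by (intro integrable_bounded_real[where B=1]) auto

lemma mean_gap_nonneg: "c \<ge> 0 \<Longrightarrow> 0 \<le> mean_gap c n i j"
  unfolding mean_gap_def using shift_gap_nonneg by (intro integral_nonneg_AE) auto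

lemma mean_gap_triangle:
  assumes "c \<ge> 0"
  shows "mean_gap c n i l \<le> mean_gap c n i j + mean_gap c n j l"
proof -
  have "min 1 (c * shift_gap x n i l) \<le> min 1 (c * shift_gap x n i j) + min 1 (c * shift_gap x n j l)" for x
  proof -
    have "c * shift_gap x n i l \<le> c * (shift_gap x n i j + shift_gap x n j l)"
      using assms by (intro mult_left_mono shift_gap_triangle)
    moreover have "0 \<le> c * shift_gap x n i j" "0 \<le> c * shift_gap x n j l"
      using assms shift_gap_nonneg by auto
    ultimately show ?thesis by (auto simp: min_def distrib_left)
  qed
  then have "mean_gap c n i l \<le> expectation (\<lambda>\<omega>. min 1 (c * shift_gap (\<lambda>k. \<xi> k \<omega>) n i j)
      + min 1 (c * shift_gap (\<lambda>k. \<xi> k \<omega>) n j l))"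
    unfolding mean_gap_def by (intro integral_mono Bochner_Integration.integrable_add min_gap_integrable assms)
  then show ?thesis
    using min_gap_integrable[OF assms] by (simp add: mean_gap_def)
qed

text \<open>Walk from delay 0 to delay \<open>j\<close> in unit steps. By stationarity each step costs the same, and backward
  steps cost the same as forward ones, so no innovation with index beyond \<open>n\<close> has to be controlled.\<close>
lemma mean_gap_le_steps:
  assumes "c \<ge> 0"
  shows "mean_gap c n 0 j \<le> real (nat \<bar>j\<bar>) * mean_gap c n 0 1"
proof -
  have pos: "mean_gap c n 0 (int l) \<le> real l * mean_gap c n 0 1" for l
  proof (induction l)
    case 0
    then show ?case by (simp add: mean_gap_def shift_gap_self)
  next
    case (Suc l)
    have "mean_gap c n (int l) (int (Suc l)) = mean_gap c n 0 1"
      using mean_gap_translate[of c n "int l" "int l" "int (Suc l)"] by simp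
    then show ?case
      using mean_gap_triangle[OF assms, of n 0 "int (Suc l)" "int l"] Suc by (simp add: algebra_simps)
  qed
  show ?thesis
  proof (cases "j \<ge> 0")
    case True
    then show ?thesis using pos[of "nat j"] by simp
  next
    case False
    have "mean_gap c n 0 j = mean_gap c n (- j) 0"
      using mean_gap_translate[of c n 0 j j] by simp
    also have "\<dots> = mean_gap c n 0 (- j)"
      by (simp add: mean_gap_def shift_gap_commute)
    finally show ?thesis using pos[of "nat (- j)"] False by simp
  qed
qed

text \<open>By stationarity the maximum of a delayed sum has the same distribution for all delays, so the bound does
  not depend on \<open>i\<close> and \<open>j\<close>.\<close>
lemma mean_gap_le_shifted_max:
  assumes "integrable M (\<xi> 0)" "c \<ge> 0"
  shows "mean_gap c n i j \<le> 2 * c * expectation (\<lambda>\<omega>. shifted_max (\<lambda>k. \<xi> k \<omega>) n 0)"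
proof -
  have "mean_gap c n i j
      \<le> expectation (\<lambda>\<omega>. c * (shifted_max (\<lambda>k. \<xi> k \<omega>) n i + shifted_max (\<lambda>k. \<xi> k \<omega>) n j))"
    unfolding mean_gap_def
  proof (rule integral_mono)
    fix \<omega>
    show "min 1 (c * shift_gap (\<lambda>k. \<xi> k \<omega>) n i j)
        \<le> c * (shifted_max (\<lambda>k. \<xi> k \<omega>) n i + shifted_max (\<lambda>k. \<xi> k \<omega>) n j)"
      by (rule min.coboundedI2, rule mult_left_mono[OF shift_gap_le_shifted_max assms(2)])
  qed (use min_gap_integrable assms shifted_max_integrable in auto)
  also have "\<dots> = 2 * c * expectation (\<lambda>\<omega>. shifted_max (\<lambda>k. \<xi> k \<omega>) n 0)"
    using shifted_max_integrable[OF assms(1)] expectation_shifted_max[of n i] expectation_shifted_max[of n j]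
    by simp
  finally show ?thesis .
qed

text \<open>Since the limit has continuous paths, its oscillation at scale \<open>1 / (m + 1)\<close> has small expectation for
  large \<open>m\<close>. Weak convergence carries this over to the partial sum process, so its jumps are
  negligible, and the remaining term \<open>c * \<bar>\<xi> 0\<bar> / b n\<close> vanishes because \<open>b n\<close> tends to infinity.\<close>
lemma mean_gap_1_tendsto_0:
  assumes int: "integrable M (\<xi> 0)"
    and pos: "\<And>n. n \<ge> 1 \<Longrightarrow> b n > 0"
    and b: "filterlim b at_top sequentially"
    and conv: "weakly_converges (mtopology_of D_unit) M (partial_sum_process b \<xi>) Z"
    and cont: "\<And>\<omega>. \<omega> \<in> space M \<Longrightarrow> continuous_on {0..1} (Z \<omega>)"
    and c: "c \<ge> 0"
  shows "(\<lambda>n. mean_gap (c / b n) n 0 1) \<longlonglongrightarrow> 0"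
proof (rule LIMSEQ_I)
  fix e :: real assume e: "e > 0"
  define osc where "osc m = oscillation c (1 / real (Suc m))" for m
  have oscc: "continuous_map (mtopology_of D_unit) euclideanreal (osc m)" for m
    using c unfolding osc_def by (intro continuous_map_oscillation) auto
  have oscb: "0 \<le> osc m x" "osc m x \<le> 1" for m x
    using c oscillation_bounds[of "1 / real (Suc m)" c x] by (auto simp: osc_def)
  have Z: "Z \<in> M \<rightarrow>\<^sub>M borel_of_top (mtopology_of D_unit)"
    and X: "partial_sum_process b \<xi> n \<in> M \<rightarrow>\<^sub>M borel_of_top (mtopology_of D_unit)" for n
    using conv by (auto simp: weakly_converges_def)
  note [measurable] = measurable_borel_of_topD[OF Z oscc] measurable_borel_of_topD[OF X oscc]
  have "(\<lambda>m. expectation (\<lambda>\<omega>. osc m (Z \<omega>))) \<longlonglongrightarrow> expectation (\<lambda>\<omega>. 0)"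
  proof (rule integral_dominated_convergence[where w="\<lambda>_. 1"])
    show "AE \<omega> in M. (\<lambda>m. osc m (Z \<omega>)) \<longlonglongrightarrow> 0"
      using oscillation_tendsto_0[OF cont c] by (auto simp: osc_def)
  qed (use oscb in auto)
  then have "eventually (\<lambda>m. expectation (\<lambda>\<omega>. osc m (Z \<omega>)) < e / 2) sequentially"
    using e by (intro order_tendstoD) auto
  then obtain m where m: "expectation (\<lambda>\<omega>. osc m (Z \<omega>)) < e / 2"
    by (auto simp: eventually_sequentially)
  have "(\<lambda>n. expectation (\<lambda>\<omega>. osc m (partial_sum_process b \<xi> n \<omega>))) \<longlonglongrightarrow> expectation (\<lambda>\<omega>. osc m (Z \<omega>))"
    using conv oscc[of m] oscb[of m] unfolding weakly_converges_def
    by (force simp: bounded_iff)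
  then have e1: "eventually (\<lambda>n. expectation (\<lambda>\<omega>. osc m (partial_sum_process b \<xi> n \<omega>)) < e / 2) sequentially"
    using m by (intro order_tendstoD) auto
  have "(\<lambda>n. c * expectation (\<lambda>\<omega>. \<bar>\<xi> 0 \<omega>\<bar>) / b n) \<longlonglongrightarrow> 0"
    by (rule real_tendsto_divide_at_top[OF tendsto_const b])
  then have e2: "eventually (\<lambda>n. c * expectation (\<lambda>\<omega>. \<bar>\<xi> 0 \<omega>\<bar>) / b n < e / 2) sequentially"
    using e by (intro order_tendstoD) auto
  have "eventually (\<lambda>n. norm (mean_gap (c / b n) n 0 1 - 0) < e) sequentially"
    using e1 e2 eventually_ge_at_top[of "Suc m"]
  proof eventually_elim
    case (elim n)
    have n: "n \<ge> 1" "1 / real n \<le> 1 / real (Suc m)"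
      using elim(3) by (auto intro!: divide_left_mono)
    have cb: "c / b n \<ge> 0" using c pos[OF n(1)] by simp
    have i1: "integrable M (\<lambda>\<omega>. c / b n * \<bar>\<xi> 0 \<omega>\<bar>)"
      using int by simp
    have i2: "integrable M (\<lambda>\<omega>. osc m (partial_sum_process b \<xi> n \<omega>))"
      using oscb by (intro integrable_bounded_real[where B=1]) auto
    have "mean_gap (c / b n) n 0 1
       \<le> expectation (\<lambda>\<omega>. c / b n * \<bar>\<xi> 0 \<omega>\<bar> + osc m (partial_sum_process b \<xi> n \<omega>))"
      unfolding mean_gap_def
    proof (rule integral_mono)
      fix \<omega>
      have "partial_sum_process b \<xi> n \<omega> = step_path n (\<lambda>k. shifted_sum (\<lambda>k. \<xi> k \<omega>) 0 k / b n)"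
        by (simp add: partial_sum_process_def step_path_def shifted_sum_def partial_sum_def)
      then show "min 1 (c / b n * shift_gap (\<lambda>k. \<xi> k \<omega>) n 0 1)
          \<le> c / b n * \<bar>\<xi> 0 \<omega>\<bar> + osc m (partial_sum_process b \<xi> n \<omega>)"
        using min_1_shift_gap_le_oscillation[OF n c pos[OF n(1)], of "\<lambda>k. \<xi> k \<omega>"] by (simp add: osc_def)
    qed (intro min_gap_integrable[OF cb] Bochner_Integration.integrable_add i1 i2)+
    also have "\<dots> = c * expectation (\<lambda>\<omega>. \<bar>\<xi> 0 \<omega>\<bar>) / b n
        + expectation (\<lambda>\<omega>. osc m (partial_sum_process b \<xi> n \<omega>))"
      using i1 i2 by simp
    also have "\<dots> < e" using elim(1,2) by linarith
    finally show ?case using mean_gap_nonneg[OF cb] by simp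
  qed
  then show "\<exists>no. \<forall>n\<ge>no. norm (mean_gap (c / b n) n 0 1 - 0) < e"
    by (simp add: eventually_sequentially)
qed

lemma mean_gap_tendsto_0:
  assumes "(\<lambda>n. mean_gap (c / b n) n 0 1) \<longlonglongrightarrow> 0" "c \<ge> 0" "\<And>n. n \<ge> 1 \<Longrightarrow> b n > 0"
  shows "(\<lambda>n. mean_gap (c / b n) n 0 j) \<longlonglongrightarrow> 0"
proof (rule tendsto_sandwich)
  have cb: "0 \<le> c / b n" if "n \<ge> 1" for n using assms that by (simp add: less_imp_le)
  show "eventually (\<lambda>n. 0 \<le> mean_gap (c / b n) n 0 j) sequentially"
    using eventually_ge_at_top[of 1] by eventually_elim (rule mean_gap_nonneg[OF cb])
  show "eventually (\<lambda>n. mean_gap (c / b n) n 0 j \<le> real (nat \<bar>j\<bar>) * mean_gap (c / b n) n 0 1) sequentially"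
    using eventually_ge_at_top[of 1] by eventually_elim (rule mean_gap_le_steps[OF cb])
  show "(\<lambda>n. real (nat \<bar>j\<bar>) * mean_gap (c / b n) n 0 1) \<longlonglongrightarrow> 0"
    using tendsto_mult_left[OF assms(1), of "real (nat \<bar>j\<bar>)"] by simp
qed auto

end

section \<open>Replacing the linear process by a multiple of its innovations\<close>

context stationary_process begin

definition linear_gap :: "(int \<Rightarrow> real) \<Rightarrow> nat \<Rightarrow> 'a \<Rightarrow> real" where
  "linear_gap a n \<omega> = (MAX k\<in>{..n}.
     \<bar>(\<Sum>\<^sub>\<infinity>j. a j) * partial_sum \<xi> k \<omega> - partial_sum (linear_process a \<xi>) k \<omega>\<bar>)"

lemma measurable_partial_sum_linear_process [measurable]:
  "partial_sum (linear_process a \<xi>) k \<in> borel_measurable M"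
proof -
  note [measurable] = measurable_linear_process[of \<xi> M a, OF measurable_innovation]
  show ?thesis unfolding partial_sum_def[abs_def] by measurable
qed

lemma measurable_linear_gap [measurable]: "linear_gap a n \<in> borel_measurable M"
  unfolding linear_gap_def[abs_def] partial_sum_def[where Y=\<xi>] by measurable

lemma linear_gap_nonneg: "0 \<le> linear_gap a n \<omega>"
proof -
  have "\<bar>(\<Sum>\<^sub>\<infinity>j. a j) * partial_sum \<xi> 0 \<omega> - partial_sum (linear_process a \<xi>) 0 \<omega>\<bar> \<le> linear_gap a n \<omega>"
    unfolding linear_gap_def by (rule Max_ge) auto
  then show ?thesis by linarith
qed

text \<open>By Fubini the expected sum of the absolute terms is the sum of \<open>\<bar>a j\<bar>\<close> times the mean of \<open>\<bar>\<xi> 0\<bar>\<close>.\<close>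
lemma AE_series_integrable:
  assumes int: "integrable M (\<xi> 0)" and a: "integrable (count_space UNIV) a"
  shows "AE \<omega> in M. \<forall>k. integrable (count_space UNIV) (\<lambda>j. a j * \<xi> (k - j) \<omega>)"
proof (subst AE_all_countable, intro allI)
  fix k
  have "(\<integral>\<^sup>+\<omega>. \<integral>\<^sup>+j. ennreal \<bar>a j * \<xi> (k - j) \<omega>\<bar> \<partial>count_space UNIV \<partial>M)
      = (\<integral>\<^sup>+j. \<integral>\<^sup>+\<omega>. ennreal \<bar>a j * \<xi> (k - j) \<omega>\<bar> \<partial>M \<partial>count_space UNIV)"
    by (intro nn_integral_count_space_nn_integral) auto
  also have "\<dots> = (\<integral>\<^sup>+j. ennreal \<bar>a j\<bar> * ennreal (expectation (\<lambda>\<omega>. \<bar>\<xi> 0 \<omega>\<bar>)) \<partial>count_space UNIV)"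
  proof (rule nn_integral_cong)
    fix j
    have "(\<integral>\<^sup>+\<omega>. ennreal \<bar>a j * \<xi> (k - j) \<omega>\<bar> \<partial>M) = ennreal (expectation (\<lambda>\<omega>. \<bar>a j * \<xi> (k - j) \<omega>\<bar>))"
      by (intro nn_integral_eq_integral) (auto simp: innovation_integrable(1)[OF int])
    also have "\<dots> = ennreal (\<bar>a j\<bar> * expectation (\<lambda>\<omega>. \<bar>\<xi> 0 \<omega>\<bar>))"
      by (simp add: abs_mult innovation_integrable(2)[OF int, of "k - j"])
    finally show "(\<integral>\<^sup>+\<omega>. ennreal \<bar>a j * \<xi> (k - j) \<omega>\<bar> \<partial>M) = ennreal \<bar>a j\<bar> * ennreal (expectation (\<lambda>\<omega>. \<bar>\<xi> 0 \<omega>\<bar>))"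
      by (simp add: ennreal_mult')
  qed
  also have "\<dots> = (\<integral>\<^sup>+j. ennreal \<bar>a j\<bar> \<partial>count_space UNIV) * ennreal (expectation (\<lambda>\<omega>. \<bar>\<xi> 0 \<omega>\<bar>))"
    by (rule nn_integral_multc) auto
  also have "\<dots> < \<infinity>"
    using a by (simp add: integrable_iff_bounded ennreal_mult_less_top)
  finally have fin: "(\<integral>\<^sup>+\<omega>. \<integral>\<^sup>+j. ennreal \<bar>a j * \<xi> (k - j) \<omega>\<bar> \<partial>count_space UNIV \<partial>M) < \<infinity>" .
  have "(\<lambda>\<omega>. \<integral>\<^sup>+j. ennreal \<bar>a j * \<xi> (k - j) \<omega>\<bar> \<partial>count_space UNIV) \<in> borel_measurable M"
  proof -
    interpret count: sigma_finite_measure "count_space (UNIV :: int set)"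
      by (rule sigma_finite_measure_count_space)
    have "(\<lambda>(\<omega>, j). ennreal \<bar>a j * \<xi> (k - j) \<omega>\<bar>) \<in> borel_measurable (M \<Otimes>\<^sub>M count_space UNIV)"
      unfolding case_prod_beta
      by (rule measurable_compose_countable'[where f="\<lambda>j p. ennreal \<bar>a j * \<xi> (k - j) (fst p)\<bar>" and g=snd and I=UNIV])
         auto
    then show ?thesis by (rule count.borel_measurable_nn_integral)
  qed
  from nn_integral_PInf_AE[OF this] fin
  have "AE \<omega> in M. (\<integral>\<^sup>+j. ennreal \<bar>a j * \<xi> (k - j) \<omega>\<bar> \<partial>count_space UNIV) \<noteq> \<infinity>"
    by simp
  then show "AE \<omega> in M. integrable (count_space UNIV) (\<lambda>j. a j * \<xi> (k - j) \<omega>)"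
    by eventually_elim (simp add: integrable_iff_bounded top.not_eq_extremum)
qed

text \<open>For almost every outcome the difference of the two partial sums at time \<open>k\<close> is the series with terms
  \<open>a j\<close> times the difference between delays 0 and \<open>j\<close>.\<close>
lemma linear_gap_le:
  assumes a: "integrable (count_space UNIV) a"
    and ser: "\<And>k. integrable (count_space UNIV) (\<lambda>j. a j * \<xi> (k - j) \<omega>)"
  shows "ennreal (linear_gap a n \<omega>)
    \<le> (\<integral>\<^sup>+j. ennreal (\<bar>a j\<bar> * shift_gap (\<lambda>k. \<xi> k \<omega>) n 0 j) \<partial>count_space UNIV)"
proof -
  have "linear_gap a n \<omega> \<in> (\<lambda>k.
     \<bar>(\<Sum>\<^sub>\<infinity>j. a j) * partial_sum \<xi> k \<omega> - partial_sum (linear_process a \<xi>) k \<omega>\<bar>) ` {..n}"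
    unfolding linear_gap_def by (rule Max_in) auto
  then obtain k where k: "k \<le> n" and
    gap: "linear_gap a n \<omega> = \<bar>(\<Sum>\<^sub>\<infinity>j. a j) * partial_sum \<xi> k \<omega> - partial_sum (linear_process a \<xi>) k \<omega>\<bar>"
    by auto
  let ?S = "shifted_sum (\<lambda>k. \<xi> k \<omega>)"
  have S: "a j * ?S j k = (\<Sum>i=1..k. a j * \<xi> (int i - j) \<omega>)" for j
    by (simp add: shifted_sum_def sum_distrib_left)
  have iS: "integrable (count_space UNIV) (\<lambda>j. a j * ?S j k)"
    unfolding S by (intro Bochner_Integration.integrable_sum ser)
  have "partial_sum (linear_process a \<xi>) k \<omega> = (\<integral>j. a j * ?S j k \<partial>count_space UNIV)"
    unfolding S by (subst Bochner_Integration.integral_sum)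
      (auto simp: ser partial_sum_def linear_process_def infsum_eq_lebesgue_count_space)
  moreover have "(\<Sum>\<^sub>\<infinity>j. a j) * partial_sum \<xi> k \<omega> = (\<integral>j. a j * ?S 0 k \<partial>count_space UNIV)"
    by (simp add: partial_sum_def shifted_sum_def infsum_eq_lebesgue_count_space)
  ultimately have "(\<Sum>\<^sub>\<infinity>j. a j) * partial_sum \<xi> k \<omega> - partial_sum (linear_process a \<xi>) k \<omega>
      = (\<integral>j. a j * (?S 0 k - ?S j k) \<partial>count_space UNIV)"
    using a iS by (simp add: right_diff_distrib)
  then have "ennreal (linear_gap a n \<omega>) = ennreal (norm (\<integral>j. a j * (?S 0 k - ?S j k) \<partial>count_space UNIV))"
    by (simp add: gap)
  also have "\<dots> \<le> (\<integral>\<^sup>+j. ennreal (norm (a j * (?S 0 k - ?S j k))) \<partial>count_space UNIV)"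
    using a iS by (intro integral_norm_bound_ennreal) (simp add: right_diff_distrib)
  also have "\<dots> \<le> (\<integral>\<^sup>+j. ennreal (\<bar>a j\<bar> * shift_gap (\<lambda>k. \<xi> k \<omega>) n 0 j) \<partial>count_space UNIV)"
    using shift_gap_upper[OF k]
    by (intro nn_integral_mono ennreal_leI) (auto simp: abs_mult intro!: mult_left_mono)
  finally show ?thesis .
qed

text \<open>The truncation \<open>min 1\<close> is passed from the series over delays to its single terms before the expectation
  is exchanged with the series; only the truncated gaps are known to tend to 0.\<close>

lemma mean_linear_gap_le:
  assumes int: "integrable M (\<xi> 0)" and a: "integrable (count_space UNIV) a" and \<beta>: "\<beta> > 0"
  shows "ennreal (expectation (\<lambda>\<omega>. min 1 (linear_gap a n \<omega> / \<beta>)))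
    \<le> (\<integral>\<^sup>+j. ennreal (mean_gap (\<bar>a j\<bar> / \<beta>) n 0 j) \<partial>count_space UNIV)"
proof -
  have "ennreal (expectation (\<lambda>\<omega>. min 1 (linear_gap a n \<omega> / \<beta>))) = (\<integral>\<^sup>+\<omega>. ennreal (min 1 (linear_gap a n \<omega> / \<beta>)) \<partial>M)"
    using linear_gap_nonneg \<beta>
    by (intro nn_integral_eq_integral[symmetric] integrable_bounded_real[where B=1]) auto
  also have "\<dots> \<le> (\<integral>\<^sup>+\<omega>. \<integral>\<^sup>+j. ennreal (min 1 (\<bar>a j\<bar> / \<beta> * shift_gap (\<lambda>k. \<xi> k \<omega>) n 0 j)) \<partial>count_space UNIV \<partial>M)"
  proof (rule nn_integral_mono_AE)
    show "AE \<omega> in M. ennreal (min 1 (linear_gap a n \<omega> / \<beta>))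
      \<le> (\<integral>\<^sup>+j. ennreal (min 1 (\<bar>a j\<bar> / \<beta> * shift_gap (\<lambda>k. \<xi> k \<omega>) n 0 j)) \<partial>count_space UNIV)"
      using AE_series_integrable[OF int a]
    proof eventually_elim
      case (elim \<omega>)
      have min_1: "ennreal (min 1 x) = min 1 (ennreal x)" if "x \<ge> 0" for x
        using min_ennreal[of 1 x] that by simp
      have "ennreal (linear_gap a n \<omega> / \<beta>) = ennreal (1 / \<beta>) * ennreal (linear_gap a n \<omega>)"
        using \<beta> linear_gap_nonneg by (simp flip: ennreal_mult)
      also have "\<dots> \<le> ennreal (1 / \<beta>) * (\<integral>\<^sup>+j. ennreal (\<bar>a j\<bar> * shift_gap (\<lambda>k. \<xi> k \<omega>) n 0 j) \<partial>count_space UNIV)"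
        using elim by (intro mult_left_mono linear_gap_le a) auto
      also have "\<dots> = (\<integral>\<^sup>+j. ennreal (1 / \<beta>) * ennreal (\<bar>a j\<bar> * shift_gap (\<lambda>k. \<xi> k \<omega>) n 0 j) \<partial>count_space UNIV)"
        by (rule nn_integral_cmult[symmetric]) auto
      also have "\<dots> = (\<integral>\<^sup>+j. ennreal (\<bar>a j\<bar> / \<beta> * shift_gap (\<lambda>k. \<xi> k \<omega>) n 0 j) \<partial>count_space UNIV)"
        using \<beta> shift_gap_nonneg by (intro nn_integral_cong) (simp flip: ennreal_mult)
      finally have "min 1 (ennreal (linear_gap a n \<omega> / \<beta>))
          \<le> min 1 (\<integral>\<^sup>+j. ennreal (\<bar>a j\<bar> / \<beta> * shift_gap (\<lambda>k. \<xi> k \<omega>) n 0 j) \<partial>count_space UNIV)"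
        by (intro min.mono order_refl)
      also have "\<dots> \<le> (\<integral>\<^sup>+j. min 1 (ennreal (\<bar>a j\<bar> / \<beta> * shift_gap (\<lambda>k. \<xi> k \<omega>) n 0 j)) \<partial>count_space UNIV)"
        by (rule min_1_nn_integral_count_space_le)
      finally show ?case
        using \<beta> linear_gap_nonneg shift_gap_nonneg by (simp add: min_1)
    qed
  qed
  also have "\<dots> = (\<integral>\<^sup>+j. \<integral>\<^sup>+\<omega>. ennreal (min 1 (\<bar>a j\<bar> / \<beta> * shift_gap (\<lambda>k. \<xi> k \<omega>) n 0 j)) \<partial>M \<partial>count_space UNIV)"
    by (intro nn_integral_count_space_nn_integral) auto
  also have "\<dots> = (\<integral>\<^sup>+j. ennreal (mean_gap (\<bar>a j\<bar> / \<beta>) n 0 j) \<partial>count_space UNIV)"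
    unfolding mean_gap_def using \<beta> shift_gap_nonneg
    by (intro nn_integral_cong nn_integral_eq_integral min_gap_integrable) auto
  finally show ?thesis .
qed

text \<open>Tannery's theorem for the series over delays: each term tends to 0, and the maximal inequality
  dominates the \<open>j\<close>-th term by \<open>2 * C * \<bar>a j\<bar>\<close> for every \<open>n \<ge> 1\<close>.\<close>
lemma mean_linear_gap_tendsto_0:
  assumes int: "integrable M (\<xi> 0)" and a: "integrable (count_space UNIV) a"
    and pos: "\<And>n. n \<ge> 1 \<Longrightarrow> b n > 0"
    and gap: "\<And>c. c \<ge> 0 \<Longrightarrow> (\<lambda>n. mean_gap (c / b n) n 0 1) \<longlonglongrightarrow> 0"
    and maximal: "\<And>n. n \<ge> 1 \<Longrightarrow> expectation (\<lambda>\<omega>. shifted_max (\<lambda>k. \<xi> k \<omega>) n 0) \<le> C * b n"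
  shows "(\<lambda>n. expectation (\<lambda>\<omega>. min 1 (linear_gap a n \<omega> / b n))) \<longlonglongrightarrow> 0"
proof -
  \<comment> \<open>The sequence starts at 1 because the sign of b 0 is arbitrary.\<close>
  have "(\<lambda>n. \<integral>\<^sup>+j. ennreal (mean_gap (\<bar>a j\<bar> / b (Suc n)) (Suc n) 0 j) \<partial>count_space UNIV)
      \<longlonglongrightarrow> (\<integral>\<^sup>+j. 0 \<partial>count_space (UNIV :: int set))"
  proof (rule nn_integral_dominated_convergence[where w="\<lambda>j. ennreal (2 * C * \<bar>a j\<bar>)"])
    fix n
    have "mean_gap (\<bar>a j\<bar> / b (Suc n)) (Suc n) 0 j \<le> 2 * C * \<bar>a j\<bar>" for j
    proof -
      have b: "b (Suc n) > 0" by (rule pos) simp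
      have "mean_gap (\<bar>a j\<bar> / b (Suc n)) (Suc n) 0 j
          \<le> 2 * (\<bar>a j\<bar> / b (Suc n)) * expectation (\<lambda>\<omega>. shifted_max (\<lambda>k. \<xi> k \<omega>) (Suc n) 0)"
        using b by (intro mean_gap_le_shifted_max int) auto
      also have "\<dots> \<le> 2 * (\<bar>a j\<bar> / b (Suc n)) * (C * b (Suc n))"
        using b by (intro mult_left_mono maximal) auto
      also have "\<dots> = 2 * C * \<bar>a j\<bar>" using b by simp
      finally show ?thesis .
    qed
    then show "AE j in count_space UNIV. ennreal (mean_gap (\<bar>a j\<bar> / b (Suc n)) (Suc n) 0 j) \<le> ennreal (2 * C * \<bar>a j\<bar>)"
      by (simp add: ennreal_leI)
  next
    have "integrable (count_space UNIV) (\<lambda>j. 2 * C * \<bar>a j\<bar>)"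
      using a by (intro integrable_mult_right integrable_abs)
    then have "(\<integral>\<^sup>+j. ennreal (norm (2 * C * \<bar>a j\<bar>)) \<partial>count_space UNIV) < \<infinity>"
      unfolding integrable_iff_bounded by blast
    moreover have "(\<integral>\<^sup>+j. ennreal (2 * C * \<bar>a j\<bar>) \<partial>count_space UNIV)
        \<le> (\<integral>\<^sup>+j. ennreal (norm (2 * C * \<bar>a j\<bar>)) \<partial>count_space UNIV)"
      by (intro nn_integral_mono ennreal_leI) simp
    ultimately show "(\<integral>\<^sup>+j. ennreal (2 * C * \<bar>a j\<bar>) \<partial>count_space UNIV) < \<infinity>"
      by (rule le_less_trans[rotated])
  next
    have "(\<lambda>n. ennreal (mean_gap (\<bar>a j\<bar> / b (Suc n)) (Suc n) 0 j)) \<longlonglongrightarrow> 0" for j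
      using LIMSEQ_Suc[OF mean_gap_tendsto_0[OF gap _ pos, of "\<bar>a j\<bar>" j]]
      by (metis abs_ge_zero ennreal_0 tendsto_ennrealI)
    then show "AE j in count_space UNIV. (\<lambda>n. ennreal (mean_gap (\<bar>a j\<bar> / b (Suc n)) (Suc n) 0 j)) \<longlonglongrightarrow> 0"
      by simp
  qed auto
  then have lim: "(\<lambda>n. \<integral>\<^sup>+j. ennreal (mean_gap (\<bar>a j\<bar> / b (Suc n)) (Suc n) 0 j) \<partial>count_space UNIV) \<longlonglongrightarrow> 0"
    by simp
  have "(\<lambda>n. ennreal (expectation (\<lambda>\<omega>. min 1 (linear_gap a (Suc n) \<omega> / b (Suc n))))) \<longlonglongrightarrow> 0"
  proof (rule tendsto_sandwich[OF _ _ tendsto_const lim])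
    show "eventually (\<lambda>n. ennreal (expectation (\<lambda>\<omega>. min 1 (linear_gap a (Suc n) \<omega> / b (Suc n))))
      \<le> (\<integral>\<^sup>+j. ennreal (mean_gap (\<bar>a j\<bar> / b (Suc n)) (Suc n) 0 j) \<partial>count_space UNIV)) sequentially"
      by (intro always_eventually allI mean_linear_gap_le int a pos) simp
  qed auto
  moreover have "0 \<le> expectation (\<lambda>\<omega>. min 1 (linear_gap a (Suc n) \<omega> / b (Suc n)))" for n
    using pos[of "Suc n"] linear_gap_nonneg by (intro integral_nonneg_AE) auto
  ultimately have "(\<lambda>n. expectation (\<lambda>\<omega>. min 1 (linear_gap a (Suc n) \<omega> / b (Suc n)))) \<longlonglongrightarrow> 0"
    using tendsto_ennreal_iff[of _ _ 0] by (simp flip: ennreal_0)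
  then show ?thesis by (rule LIMSEQ_imp_Suc)
qed

end

section \<open>The invariance principle for the linear process\<close>

theorem theorem5:
  fixes M :: "'a measure"
    and \<xi> :: "int \<Rightarrow> 'a \<Rightarrow> real"
    and a :: "int \<Rightarrow> real"
    and b :: "nat \<Rightarrow> real"
    and C :: real
    and \<eta> :: "'a \<Rightarrow> real"
    and W :: "real \<Rightarrow> 'a \<Rightarrow> real"
  assumes "prob_space M"
    and "stationary_sequence M \<xi>"
    and "integrable M (\<xi> 0)"
    and "(\<integral>\<omega>. \<xi> 0 \<omega> \<partial>M) = 0"
    and "(\<lambda>j. \<bar>a j\<bar>) summable_on UNIV"
    and "C > 0"
    and "\<And>n. n \<ge> 1 \<Longrightarrow> b n > 0"
    and "filterlim b at_top sequentially"
    and "\<And>n. n \<ge> 1 \<Longrightarrow> (\<integral>\<omega>. (MAX j\<in>{1..n}. \<bar>partial_sum \<xi> j \<omega>\<bar>) \<partial>M) \<le> C * b n"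
    and "\<eta> \<in> borel_measurable (invariant_field M \<xi>)"
    and "standard_brownian_motion M W"
    and "prob_space.indep_set M (sets (invariant_field M \<xi>)) (sets (process_field M W))"
    and "weakly_converges (mtopology_of D_unit) M (partial_sum_process b \<xi>)
           (\<lambda>\<omega>. \<lambda>t\<in>{0..1}. \<eta> \<omega> * W t \<omega>)"
  shows "weakly_converges (mtopology_of D_unit) M (partial_sum_process b (linear_process a \<xi>))
           (\<lambda>\<omega>. \<lambda>t\<in>{0..1}. \<eta> \<omega> * (\<Sum>\<^sub>\<infinity>j. a j) * W t \<omega>)"
proof -
  interpret stationary_process M \<xi>
    using assms(1,2) by (simp add: stationary_process_def stationary_process_axioms_def)
  define A where "A = (\<Sum>\<^sub>\<infinity>j. a j)"
  define Z where "Z = (\<lambda>\<omega>. \<lambda>t\<in>{0..1}. \<eta> \<omega> * W t \<omega>)"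
  have a: "integrable (count_space UNIV) a"
    using assms(5) by (simp add: integrable_count_space_iff_abs_summable)
  have conv: "weakly_converges (mtopology_of D_unit) M (partial_sum_process b \<xi>) Z"
    using assms(13) by (simp add: Z_def)
  have process: "partial_sum_process b Y n = (\<lambda>\<omega>. step_path n (\<lambda>k. partial_sum Y k \<omega> / b n))" for Y n
    by (simp add: fun_eq_iff partial_sum_process_def step_path_def)
  have cont: "continuous_on {0..1} (Z \<omega>)" if "\<omega> \<in> space M" for \<omega>
  proof -
    have "continuous_on {0..1} (\<lambda>t. \<eta> \<omega> * W t \<omega>)"
      using assms(11) that by (intro continuous_intros) (simp add: standard_brownian_motion_def)
    then show ?thesis
      by (rule continuous_on_eq) (simp add: Z_def)
  qed
  have maximal: "expectation (\<lambda>\<omega>. shifted_max (\<lambda>k. \<xi> k \<omega>) n 0) \<le> C * b n" if "n \<ge> 1" for n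
  proof -
    have "shifted_max (\<lambda>k. \<xi> k \<omega>) n 0 = (MAX j\<in>{1..n}. \<bar>partial_sum \<xi> j \<omega>\<bar>)" for \<omega>
    proof (rule antisym)
      have ub: "\<bar>partial_sum \<xi> k \<omega>\<bar> \<le> (MAX j\<in>{1..n}. \<bar>partial_sum \<xi> j \<omega>\<bar>)" if "k \<in> {1..n}" for k
        using that by (intro Max_ge) auto
      have "0 \<le> (MAX j\<in>{1..n}. \<bar>partial_sum \<xi> j \<omega>\<bar>)"
        by (rule order_trans[OF abs_ge_zero ub[of 1]]) (use \<open>n \<ge> 1\<close> in simp)
      then have "\<bar>partial_sum \<xi> k \<omega>\<bar> \<le> (MAX j\<in>{1..n}. \<bar>partial_sum \<xi> j \<omega>\<bar>)" if "k \<le> n" for k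
        using ub[of k] that by (cases "k = 0") (auto simp: partial_sum_def)
      then show "shifted_max (\<lambda>k. \<xi> k \<omega>) n 0 \<le> (MAX j\<in>{1..n}. \<bar>partial_sum \<xi> j \<omega>\<bar>)"
        unfolding shifted_max_def shifted_sum_def by (intro Max.boundedI) (auto simp: partial_sum_def)
      show "(MAX j\<in>{1..n}. \<bar>partial_sum \<xi> j \<omega>\<bar>) \<le> shifted_max (\<lambda>k. \<xi> k \<omega>) n 0"
        unfolding shifted_max_def shifted_sum_def using \<open>n \<ge> 1\<close>
        by (intro Max_mono) (auto simp: partial_sum_def)
    qed
    then show ?thesis using assms(9)[OF that] by simp
  qed
  have "weakly_converges (mtopology_of D_unit) M (partial_sum_process b (linear_process a \<xi>)) (\<lambda>\<omega>. scale_path A (Z \<omega>))"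
  proof (rule weakly_converges_close[OF weakly_converges_continuous_mapping[OF conv continuous_map_scale_path]])
    show "partial_sum_process b (linear_process a \<xi>) n \<in> M \<rightarrow>\<^sub>M borel_of_top (mtopology_of D_unit)" for n
      unfolding process by (rule measurable_step_path) measurable
    \<comment> \<open>The absolute value only matters at n = 0, where b 0 may be negative.\<close>
    show "(\<lambda>\<omega>. linear_gap a n \<omega> / \<bar>b n\<bar>) \<in> borel_measurable M" for n
      by measurable
    show "0 \<le> linear_gap a n \<omega> / \<bar>b n\<bar>" for n \<omega>
      using linear_gap_nonneg by simp
    have "mdist D_unit (scale_path A (partial_sum_process b \<xi> n \<omega>)) (partial_sum_process b (linear_process a \<xi>) n \<omega>)
       \<le> linear_gap a n \<omega> / \<bar>b n\<bar>" for n \<omega>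
    proof -
      have "scale_path A (partial_sum_process b \<xi> n \<omega>) = step_path n (\<lambda>k. A * partial_sum \<xi> k \<omega> / b n)"
        by (auto simp: process scale_path_def step_path_def fun_eq_iff)
      moreover have "\<bar>A * partial_sum \<xi> k \<omega> / b n - partial_sum (linear_process a \<xi>) k \<omega> / b n\<bar>
          \<le> linear_gap a n \<omega> / \<bar>b n\<bar>" if "k \<le> n" for k
      proof -
        have "\<bar>A * partial_sum \<xi> k \<omega> - partial_sum (linear_process a \<xi>) k \<omega>\<bar> \<le> linear_gap a n \<omega>"
          unfolding linear_gap_def A_def by (rule Max_ge) (use that in auto)
        then show ?thesis
          by (simp add: abs_divide divide_right_mono flip: diff_divide_distrib)
      qed
      ultimately show ?thesis
        by (simp add: process mdist_step_path_le)
    qed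
    then show "eventually (\<lambda>n. AE \<omega> in M. mdist D_unit (scale_path A (partial_sum_process b \<xi> n \<omega>))
        (partial_sum_process b (linear_process a \<xi>) n \<omega>) \<le> linear_gap a n \<omega> / \<bar>b n\<bar>) sequentially"
      by simp
    have "(\<lambda>n. expectation (\<lambda>\<omega>. min 1 (linear_gap a n \<omega> / b n))) \<longlonglongrightarrow> 0"
      using mean_gap_1_tendsto_0[OF assms(3) assms(7,8) conv cont]
      by (intro mean_linear_gap_tendsto_0[OF assms(3) a assms(7) _ maximal])
    moreover have "eventually (\<lambda>n. expectation (\<lambda>\<omega>. min 1 (linear_gap a n \<omega> / b n)) =
        expectation (\<lambda>\<omega>. min 1 (linear_gap a n \<omega> / \<bar>b n\<bar>))) sequentially"
      using eventually_ge_at_top[of 1]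
      by eventually_elim (use assms(7) in \<open>simp add: abs_of_pos\<close>)
    ultimately show "(\<lambda>n. expectation (\<lambda>\<omega>. min 1 (linear_gap a n \<omega> / \<bar>b n\<bar>))) \<longlonglongrightarrow> 0"
      by (rule Lim_transform_eventually)
  qed
  moreover have "(\<lambda>\<omega>. scale_path A (Z \<omega>)) = (\<lambda>\<omega>. \<lambda>t\<in>{0..1}. \<eta> \<omega> * (\<Sum>\<^sub>\<infinity>j. a j) * W t \<omega>)"
    by (auto simp: scale_path_def Z_def A_def fun_eq_iff)
  ultimately show ?thesis by simp
qed

end
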